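(* There exists a unique series $$g(x)=x+\sum_{i=1}^\infty b_ix^{i+1},\qquad b_i\in S^*,$$ such that $s_w g(x)=0$ for any geometric cobordism element $x$ and for all $w$ with $\deg w>0$. This series is a logarithm of the formal group $f$, i.e. $f(x_1,x_2)=g^{-1}(g(x_1)+g(x_2))$, and it satisfies the condition $$x=g(x)+\sum_{k=1}^\infty s_k^*\,g(x)^{k+1},$$ i.e. $g^{-1}(t)=t+\sum_{k=1}^\infty s_k^*t^{k+1}$, where the $s_k^*$ are the multiplicative generators of $S^*$ dual to $s_{(k)}\in S$ (with respect to the $\mathbb Z$-basis $\{s_w\}$ of $S$).
   Context: The Landweber–Novikov algebra $S$ is the Hopf algebra over $\mathbb Z$ defined as follows. Additively it is free abelian with basis $s_w$, where $w=(k_1,\dots,k_l)$ runs over finite unordered collections of positive integers including the empty one; $s_\emptyset=1$, and $s_w$ has degree $\deg w=2\sum_j k_j$. The coproduct is $\Delta s_w=\sum_{(w',w'')=w}s_{w'}\otimes s_{w''}$ (sum over splittings of the collection $w$ into two collections). On polynomial rings $\mathbb Z[y_1,\dots,y_N]$ the $s_w$ act by $s_{(k)}(y_j)=y_j^{k+1}$, $s_w(y_j)=0$ if $l>1$, and the Cartan formula $s_w(uv)=\sum_{(w',w'')=w}s_{w'}(u)s_{w''}(v)$; the product of $S$ is the unique one making these rings left $S$-modules for all $N$ (for every $s\in S$, $s\neq0$, one has $s(y_1\cdots y_N)\ne0$ for $N$ large). $S^*$ is the (graded) dual Hopf algebra: the polynomial ring over $\mathbb Z$ on generators $s_k^*$,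 $k\ge1$, where $(s_k^*,s_w)=1$ if $w=(k)$ and $0$ otherwise. $S$ acts on $S^*$ by $s(\lambda)=R_s^*(\lambda)$, where $(R_s^*(\lambda),s')=(\lambda,s's)$. A Milnor module over $S$ is a ring on which $S$ acts with $s(uv)=\sum s_i'(u)s_i''(v)$ whenever $\Delta s=\sum s_i'\otimes s_i''$. A geometric cobordism element is an element $x$ of degree $2$ with $s_{(k)}(x)=x^{k+1}$ for all $k\ge1$ and $s_w(x)=0$ for $w=(k_1,\dots,k_l)$, $l>1$. The power series rings $S^*[[x]]$ and $S^*[[x_1,x_2]]$ are Milnor modules via the action $R^*$ on $S^*$ and the requirement that the variables are geometric cobordism elements. The formal group $f(x_1,x_2)=x_1+x_2+\sum_{i,j\ge1}\alpha_{ij}x_1^ix_2^j$, $\alpha_{ij}\in S^*$, is the unique series of this form which is a geometric cobordism element provided $x_1$ and $x_2$ are geometric cobordism elements. $g^{-1}$ denotes the compositional inverse series.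
   Formalization: Uniqueness of g is among series homogeneous of degree 2, i.e. deg b_i = -2i; without this g + g^2 is a second series killed by all s_w with deg w > 0. Annihilation is stated for x in Hausdorff filtered Milnor S^*-algebras, where g(x) makes sense. *)

theory Defs
  imports
    "HOL-Library.Multiset"
    "HOL-Library.Poly_Mapping"
    "HOL-Computational_Algebra.Formal_Power_Series"
begin

unbundle fps_syntax

section \<open>The free abelian group with basis $s_w$\<close>

text \<open>A collection $w = (k_1, \dots, k_l)$ is a finite multiset over \<^typ>\<open>num\<close>, the library's type of
  strictly positive integers.\<close>

type_synonym coll = "num multiset"

definition coll_degree :: "coll \<Rightarrow> nat" where
  "coll_degree w = 2 * (\<Sum>k\<in>#w. nat_of_num k)"

text \<open>Every ordered pair of collections with sum \<open>w\<close> occurs exactly once, also when \<open>w\<close> has repeated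
  entries. This is forced by the Cartan formula on $y_1 y_2$, and it makes $S^*$ a polynomial ring.\<close>

definition splittings :: "coll \<Rightarrow> (coll \<times> coll) set" where
  "splittings w = {(w', w''). w' + w'' = w}"

text \<open>The underlying group of $S$. The library multiplication on this type is \<^emph>\<open>not\<close> the product of $S$;
  the latter is \<open>LN_times\<close> below. The library unit is $s_\emptyset$.\<close>

type_synonym LN = "coll \<Rightarrow>\<^sub>0 int"

abbreviation s_elem :: "coll \<Rightarrow> LN" where
  "s_elem w \<equiv> frag_of w"

section \<open>Actions and the product of $S$\<close>

text \<open>The Cartan formula for arbitrary \<open>s\<close> follows from the one for the basis elements by additivity.\<close>

definition cartan_action :: "(LN \<Rightarrow> 'a::ring_1 \<Rightarrow> 'a) \<Rightarrow> bool" where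
  "cartan_action A \<longleftrightarrow>
     (\<forall>s t u. A (s + t) u = A s u + A t u) \<and>
     (\<forall>s u v. A s (u + v) = A s u + A s v) \<and>
     (\<forall>u. A (s_elem {#}) u = u) \<and>
     (\<forall>w u v. A (s_elem w) (u * v) =
        (\<Sum>(w', w'')\<in>splittings w. A (s_elem w') u * A (s_elem w'') v))"

definition geometric_operations :: "(LN \<Rightarrow> 'a::ring_1 \<Rightarrow> 'a) \<Rightarrow> 'a \<Rightarrow> bool" where
  "geometric_operations A x \<longleftrightarrow>
     (\<forall>k. A (s_elem {#k#}) x = x ^ (nat_of_num k + 1)) \<and>
     (\<forall>w. size w > 1 \<longrightarrow> A (s_elem w) x = 0)"

text \<open>The union of the rings $\mathbf Z[y_1, \dots, y_N]$ over all $N$, with the variables indexed from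
  0; a monomial is the multiset of its variables. The formulas for the action do not involve $N$, so
  an identity for all $N$ is an identity on the union.\<close>

type_synonym ypoly = "nat multiset \<Rightarrow>\<^sub>0 int"

definition y_var :: "nat \<Rightarrow> ypoly" where
  "y_var j = Poly_Mapping.single {#j#} 1"

definition ypoly_act :: "LN \<Rightarrow> ypoly \<Rightarrow> ypoly" where
  "ypoly_act = (THE A. cartan_action A \<and> (\<forall>j. geometric_operations A (y_var j)))"

definition LN_times :: "LN \<Rightarrow> LN \<Rightarrow> LN" where
  "LN_times s t = (THE u. \<forall>p. ypoly_act u p = ypoly_act s (ypoly_act t p))"

definition milnor_module :: "(LN \<Rightarrow> 'a::ring_1 \<Rightarrow> 'a) \<Rightarrow> bool" where
  "milnor_module A \<longleftrightarrow>
     cartan_action A \<and> (\<forall>s t u. A (LN_times s t) u = A s (A t u))"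

text \<open>The argument \<open>gr\<close> gives the homogeneous components \<open>gr d\<close> of the ring; no property of the
  grading is required.\<close>

definition geometric_cobordism ::
    "(LN \<Rightarrow> 'a::ring_1 \<Rightarrow> 'a) \<Rightarrow> (int \<Rightarrow> 'a set) \<Rightarrow> 'a \<Rightarrow> bool" where
  "geometric_cobordism A gr x \<longleftrightarrow> x \<in> gr 2 \<and> geometric_operations A x"

section \<open>The graded dual\<close>

text \<open>$S$ has finite rank in each degree, so its graded dual has as basis the dual basis of the $s_w$, and
  its elements are finitely supported functions on collections. Here the library multiplication
  \<^emph>\<open>is\<close> the product of $S^*$, the one dual to the coproduct (lemma \<open>pairing_times\<close>), and it is
  that of the polynomial ring on the generators \<open>s_dual k\<close>.\<close>

type_synonym LNdual = "coll \<Rightarrow>\<^sub>0 int"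

definition pairing :: "LNdual \<Rightarrow> LN \<Rightarrow> int" where
  "pairing l s = (\<Sum>w\<in>Poly_Mapping.keys s. Poly_Mapping.lookup l w * Poly_Mapping.lookup s w)"

definition s_dual :: "num \<Rightarrow> LNdual" where
  "s_dual k = Poly_Mapping.single {#k#} 1"

lemma pairing_s_elem: "pairing l (s_elem w) = Poly_Mapping.lookup l w"
  by (simp add: pairing_def)

lemma pairing_s_dual: "pairing (s_dual k) (s_elem w) = (if w = {#k#} then 1 else 0)"
  by (auto simp: pairing_s_elem s_dual_def lookup_single)

lemma splittings_eq: "splittings w = (\<lambda>v. (v, w - v)) ` {v. v \<subseteq># w}"
  by (force simp: splittings_def image_iff)

lemma finite_submultisets: "finite {v. v \<subseteq># w}"
proof (induction w)
  case empty
  then show ?case by simp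
next
  case (add a w)
  have "v \<in> {v. v \<subseteq># w} \<union> add_mset a ` {v. v \<subseteq># w}" if "v \<subseteq># add_mset a w" for v
  proof (cases "a \<in># v")
    case True
    then obtain u where "v = add_mset a u" by (meson multi_member_split)
    with that show ?thesis by simp
  next
    case False
    with that have "v \<subseteq># w"
      by (metis add_mset_remove_trivial diff_single_trivial subset_eq_diff_conv union_single_eq_member
          add_mset_add_single)
    then show ?thesis by simp
  qed
  then have "{v. v \<subseteq># add_mset a w} \<subseteq> {v. v \<subseteq># w} \<union> add_mset a ` {v. v \<subseteq># w}"
    by blast
  then show ?case using add.IH by (meson finite_UnI finite_imageI finite_subset)
qed

lemma finite_splittings: "finite (splittings w)"
  by (simp add: splittings_eq finite_submultisets)

lemma pairing_times:
  "pairing (l * m) (s_elem w) =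
     (\<Sum>(w', w'')\<in>splittings w. pairing l (s_elem w') * pairing m (s_elem w''))"
proof -
  have *: "Sum_any (\<lambda>q. Poly_Mapping.lookup m q when w = v + q) =
      (Poly_Mapping.lookup m (w - v) when v \<subseteq># w)" for v
  proof (cases "v \<subseteq># w")
    case True
    then have "(\<lambda>q. Poly_Mapping.lookup m q when w = v + q) =
        (\<lambda>q. Poly_Mapping.lookup m q when q = w - v)"
      by (auto simp: fun_eq_iff when_def)
    then have "Sum_any (\<lambda>q. Poly_Mapping.lookup m q when w = v + q) =
        Sum_any (\<lambda>q. Poly_Mapping.lookup m q when q = w - v)"
      by (rule arg_cong)
    then show ?thesis using True by (simp add: Sum_any_when_equal)
  next
    case False
    then have "(\<lambda>q. Poly_Mapping.lookup m q when w = v + q) = (\<lambda>q. 0)"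
      by (auto simp: fun_eq_iff when_def)
    then show ?thesis using False by (simp only: Sum_any.neutral when_simps)
  qed
  have "Poly_Mapping.lookup (l * m) w =
      Sum_any (\<lambda>v. Poly_Mapping.lookup l v * (Poly_Mapping.lookup m (w - v) when v \<subseteq># w))"
    by (simp add: lookup_mult *)
  also have "\<dots> = (\<Sum>v\<in>{v. v \<subseteq># w}.
      Poly_Mapping.lookup l v * (Poly_Mapping.lookup m (w - v) when v \<subseteq># w))"
    by (rule Sum_any.expand_superset) (auto simp: when_def finite_submultisets split: if_splits)
  also have "\<dots> = (\<Sum>v\<in>{v. v \<subseteq># w}. Poly_Mapping.lookup l v * Poly_Mapping.lookup m (w - v))"
    by (rule sum.cong) auto
  also have "\<dots> = (\<Sum>(w', w'')\<in>splittings w. Poly_Mapping.lookup l w' * Poly_Mapping.lookup m w'')"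
    unfolding splittings_eq by (subst sum.reindex) (auto simp: inj_on_def)
  finally show ?thesis by (simp add: pairing_s_elem)
qed

definition R_star :: "LN \<Rightarrow> LNdual \<Rightarrow> LNdual" where
  "R_star s l = (THE m. \<forall>s'. pairing m s' = pairing l (LN_times s' s))"

text \<open>Operations raise degree by \<open>coll_degree\<close>, so \<open>s_dual k\<close> has degree $-2k$.\<close>

definition dual_component :: "int \<Rightarrow> LNdual set" where
  "dual_component d = {l. \<forall>w\<in>Poly_Mapping.keys l. - int (coll_degree w) = d}"

section \<open>Power series over the graded dual\<close>

definition series_component :: "int \<Rightarrow> LNdual fps set" where
  "series_component d = {F. \<forall>i. F $ i \<in> dual_component (d - 2 * int i)}"

text \<open>In the next definition, as in \<open>series2_act\<close>, continuity need not be required: by the Cartan formula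
  every $s_w$ preserves the ideals generated by powers of a variable.\<close>

definition series_act :: "LN \<Rightarrow> LNdual fps \<Rightarrow> LNdual fps" where
  "series_act = (THE A. milnor_module A \<and>
     (\<forall>s l. A s (fps_const l) = fps_const (R_star s l)) \<and>
     geometric_cobordism A series_component fps_X)"

text \<open>$S^*[[x_1, x_2]] = S^*[[x_1]][[x_2]]$: the coefficient of $x_1^i x_2^j$ in \<open>F\<close> is \<open>F $ j $ i\<close>.\<close>

definition var1 :: "LNdual fps fps" where "var1 = fps_const fps_X"
definition var2 :: "LNdual fps fps" where "var2 = fps_X"

definition series2_component :: "int \<Rightarrow> LNdual fps fps set" where
  "series2_component d =
     {F. \<forall>i j. F $ j $ i \<in> dual_component (d - 2 * int i - 2 * int j)}"

definition series2_act :: "LN \<Rightarrow> LNdual fps fps \<Rightarrow> LNdual fps fps" where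
  "series2_act = (THE A. milnor_module A \<and>
     (\<forall>s l. A s (fps_const (fps_const l)) = fps_const (fps_const (R_star s l))) \<and>
     geometric_cobordism A series2_component var1 \<and>
     geometric_cobordism A series2_component var2)"

text \<open>The value $g(F)$ of a series at \<open>F\<close> in $S^*[[x_1, x_2]]$ with zero constant term (so that $F^n$ has no
  terms of order below $n$). The library composition does not apply, since \<open>F $ 0\<close> need not vanish.\<close>

definition subst2 :: "LNdual fps \<Rightarrow> LNdual fps fps \<Rightarrow> LNdual fps fps" where
  "subst2 g F = Abs_fps (\<lambda>j. Abs_fps (\<lambda>i. \<Sum>n\<le>i + j. g $ n * (F ^ n) $ j $ i))"

definition formal_group :: "LNdual fps fps" where
  "formal_group = (THE f.
     (\<forall>i j. i = 0 \<or> j = 0 \<longrightarrow> f $ j $ i = (if i + j = 1 then 1 else 0)) \<and>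
     geometric_cobordism series2_act series2_component f)"

text \<open>The library inverse \<^const>\<open>fps_inv\<close> is only available over a field.\<close>

definition comp_inverse :: "'a::comm_ring_1 fps \<Rightarrow> 'a fps" where
  "comp_inverse g = (THE h. h $ 0 = 0 \<and> g oo h = fps_X \<and> h oo g = fps_X)"

text \<open>$\sum_{k \ge 1} s_k^* t^{k+1}$\<close>

definition dual_series :: "LNdual fps" where
  "dual_series = Abs_fps (\<lambda>n. if n < 2 then 0 else s_dual (num_of_nat (n - 1)))"

text \<open>The series $g(x) = x + \sum_i b_i x^{i+1}$ annihilated by the positive part of $S$, where \<open>x\<close> is the
  universal geometric cobordism element, the variable of $S^*[[x]]$. As for every element of degree 2,
  $g(x)$ is meant to be homogeneous, that is, $b_i$ has degree $-2i$. Without this condition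
  $g(x) + g(x)^2$ would be a second solution.\<close>

definition invariant_series :: "LNdual fps \<Rightarrow> bool" where
  "invariant_series g \<longleftrightarrow>
     g $ 0 = 0 \<and> g $ 1 = 1 \<and> g \<in> series_component 2 \<and>
     (\<forall>w. coll_degree w > 0 \<longrightarrow> series_act (s_elem w) g = 0)"

section \<open>Values of series in arbitrary Milnor modules\<close>

text \<open>For $g(x)$ to make sense for an element \<open>x\<close> of a Milnor module, the module must be an algebra over
  $S^*$ (via an equivariant homomorphism \<open>\<iota>\<close>) with a Hausdorff filtration \<open>F\<close>, preserved by the
  action, in which \<open>x\<close> has positive filtration. Examples are $S^*[[x]]$ and $S^*[[x_1, x_2]]$ with the
  adic filtration, or any such algebra with $F_1$ a nilpotent ideal.\<close>

definition filtered_milnor_algebra ::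
    "(LN \<Rightarrow> 'm::ring_1 \<Rightarrow> 'm) \<Rightarrow> (LNdual \<Rightarrow> 'm) \<Rightarrow> (nat \<Rightarrow> 'm set) \<Rightarrow> bool" where
  "filtered_milnor_algebra A \<iota> F \<longleftrightarrow>
     milnor_module A \<and>
     \<iota> 1 = 1 \<and> (\<forall>l m. \<iota> (l + m) = \<iota> l + \<iota> m) \<and> (\<forall>l m. \<iota> (l * m) = \<iota> l * \<iota> m) \<and>
     (\<forall>s l. A s (\<iota> l) = \<iota> (R_star s l)) \<and>
     F 0 = UNIV \<and> (\<forall>n. F (Suc n) \<subseteq> F n) \<and> (\<Inter>n. F n) = {0} \<and>
     (\<forall>n. \<forall>u\<in>F n. \<forall>v\<in>F n. u - v \<in> F n) \<and>
     (\<forall>m n. \<forall>u\<in>F m. \<forall>v\<in>F n. u * v \<in> F (m + n)) \<and>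
     (\<forall>s n. \<forall>u\<in>F n. A s u \<in> F n)"

definition is_series_value ::
    "(LNdual \<Rightarrow> 'm::ring_1) \<Rightarrow> (nat \<Rightarrow> 'm set) \<Rightarrow> LNdual fps \<Rightarrow> 'm \<Rightarrow> 'm \<Rightarrow> bool" where
  "is_series_value \<iota> F g x y \<longleftrightarrow> (\<forall>n. y - (\<Sum>i<n. \<iota> (g $ i) * x ^ i) \<in> F n)"

end

theory Submission
  imports Defs
begin

text \<open>The total operation $u \mapsto \sum_w s_w(u)\, b^w$ of a Milnor module is a ring homomorphism. On
  a geometric cobordism element it is substitution into $\beta(x) = x + \sum_k b_k x^{k+1}$. Composing two
  such substitutions computes the product of \<open>S\<close>, and dually the total operation of $R^*$ acts on the
  coefficients of $\sigma(t) = t + \sum_k s_k^* t^{k+1}$ by $\sigma \mapsto \beta \circ \sigma$. For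
  $g = \sigma^{-1}$ the two substitutions cancel in $\sigma(g(x)) = x$, so $g(x)$ is invariant.
  Conversely, the coefficients of $h \circ \sigma$ are invariant if $h(x)$ is, and a homogeneous invariant
  element of $S^*$ of nonzero degree vanishes. The same argument, carried out in both variables, shows that
  an invariant series of degree 2 in $S^*[[x_1, x_2]]$ is determined by its linear terms. This applies to
  $g(f(x_1, x_2))$ and $g(x_1) + g(x_2)$.\<close>

section \<open>Sums over splittings\<close>

text \<open>The polynomial action, the product of S, \<open>R_star\<close>, the actions on series
  and the formal group are all given by definite descriptions, so each needs existence and
  uniqueness before it can be used. The actions on polynomials and series are read off from ring
  homomorphisms into \<open>opseries\<close>; they are unique because generators determine them and
  operations cannot lower adic order. The product has no formula to start from: structure constants
  are obtained by expanding the composite substitution, verified on generators, products and limits,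
  and identified with the product by faithfulness on y_0 ... y_{n-1}. Their homogeneity keeps all
  sums finite. The formal group exists because g does: for the invariant y = g(x_1) + g(x_2),
  operations act on \<sigma>(y) through the coefficients of \<sigma> alone, which gives powers of
  \<sigma>(y). Degree 0 is exceptional: integers are invariant, and only the prescribed linear terms
  remove this freedom.\<close>

definition weight :: "coll \<Rightarrow> nat" where
  "weight w = (\<Sum>k\<in>#w. nat_of_num k)"

lemma weight_empty [simp]: "weight {#} = 0"
  and weight_add [simp]: "weight (v + w) = weight v + weight w"
  and weight_add_mset [simp]: "weight (add_mset k w) = nat_of_num k + weight w"
  by (simp_all add: weight_def)

lemma coll_degree_weight: "coll_degree w = 2 * weight w"
  by (simp add: coll_degree_def weight_def)

lemma nat_of_num_neq_0 [simp]: "nat_of_num k \<noteq> 0"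
  using nat_of_num_pos[of k] by simp

lemma weight_eq_0_iff [simp]: "weight w = 0 \<longleftrightarrow> w = {#}"
  by (cases w) auto

lemma size_le_weight: "size w \<le> weight w"
proof (induction w)
  case (add k w)
  then show ?case using nat_of_num_pos[of k] by simp
qed simp

text \<open>Entries are positive, so such a collection has at most n entries, each at most
  n.\<close>

lemma finite_weight_le: "finite {w. weight w \<le> n}"
proof -
  let ?K = "num_of_nat ` {..n}"
  have "w \<in> mset ` {xs. set xs \<subseteq> ?K \<and> length xs \<le> n}" if w: "weight w \<le> n" for w
  proof -
    obtain xs where xs: "mset xs = w" using ex_mset by blast
    have "k \<in> ?K" if "k \<in># w" for k
    proof -
      have "nat_of_num k \<le> weight w" using multi_member_split[OF that] by auto
      then have "nat_of_num k \<le> n" using w by simp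
      then show ?thesis
        by (metis atMost_iff imageI nat_of_num_inverse)
    qed
    then have "set xs \<subseteq> ?K" using xs by auto
    moreover have "length xs \<le> n" using size_le_weight[of w] w xs by (metis le_trans size_mset)
    ultimately show ?thesis using xs by blast
  qed
  then have "{w. weight w \<le> n} \<subseteq> mset ` {xs. set xs \<subseteq> ?K \<and> length xs \<le> n}" by blast
  moreover have "finite {xs. set xs \<subseteq> ?K \<and> length xs \<le> n}"
    by (rule finite_lists_length_le) simp
  ultimately show ?thesis by (meson finite_imageI finite_subset)
qed

text \<open>The index of b_n under the convention b_0 = 1, so that s_empty and the s_(k) share one
  formula.\<close>

definition row :: "nat \<Rightarrow> coll" where
  "row n = (if n = 0 then {#} else {#num_of_nat n#})"

lemma weight_row [simp]: "weight (row n) = n"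
  by (simp add: row_def num_of_nat_inverse)

lemma size_row: "size (row n) \<le> 1"
  by (simp add: row_def)

lemma size_le_1_iff_row: "size w \<le> 1 \<longleftrightarrow> w = row (weight w)"
proof
  assume "size w \<le> 1"
  then consider "size w = 0" | "size w = Suc 0" by linarith
  then show "w = row (weight w)"
  proof cases
    case 2
    then obtain k where "w = {#k#}" using size_1_singleton_mset[of w] by auto
    then show ?thesis by (simp add: row_def nat_of_num_inverse)
  qed (simp add: row_def)
qed (metis size_row)

lemma sum_splittings_commute:
  "(\<Sum>(u, v)\<in>splittings w. h u v) = (\<Sum>(u, v)\<in>splittings w. h v u)"
  by (rule sum.reindex_bij_witness[where i = prod.swap and j = prod.swap])
    (auto simp: splittings_def add.commute)

text \<open>Coassociativity: both sides run over the ordered triples with sum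
  \<open>w\<close>.\<close>

lemma sum_splittings_assoc:
  "(\<Sum>(u, c)\<in>splittings w. \<Sum>(a, b)\<in>splittings u. h a b c) =
   (\<Sum>(a, u)\<in>splittings w. \<Sum>(b, c)\<in>splittings u. h a b c)"
proof -
  have "(\<Sum>(u, c)\<in>splittings w. \<Sum>(a, b)\<in>splittings u. h a b c) =
      (\<Sum>(p, q)\<in>Sigma (splittings w) (\<lambda>p. splittings (fst p)). h (fst q) (snd q) (snd p))"
    by (simp add: sum.Sigma finite_splittings case_prod_beta)
  also have "\<dots> = (\<Sum>(p, q)\<in>Sigma (splittings w) (\<lambda>p. splittings (snd p)). h (fst p) (fst q) (snd q))"
    by (rule sum.reindex_bij_witness[where
          j = "\<lambda>(p, q). ((fst q, snd q + snd p), (snd q, snd p))" and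
          i = "\<lambda>(p, q). ((fst p + fst q, snd q), (fst p, fst q))"])
      (auto simp: splittings_def add.assoc)
  also have "\<dots> = (\<Sum>(a, u)\<in>splittings w. \<Sum>(b, c)\<in>splittings u. h a b c)"
    by (simp add: sum.Sigma finite_splittings case_prod_beta)
  finally show ?thesis .
qed

lemma sum_splittings_delta:
  "(\<Sum>(u, v)\<in>splittings w. if v = a then f u else 0) = (if a \<subseteq># w then f (w - a) else (0::'a::comm_monoid_add))"
proof -
  have "(\<Sum>(u, v)\<in>splittings w. if v = a then f u else 0) =
      (\<Sum>p\<in>splittings w. if p = (w - a, a) then f (w - a) else 0)"
    by (rule sum.cong) (auto simp: splittings_def split: if_splits)
  also have "\<dots> = (if a \<subseteq># w then f (w - a) else 0)"
  proof -
    have "(w - a, a) \<in> splittings w \<longleftrightarrow> a \<subseteq># w"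
      by (simp add: splittings_def) (metis mset_subset_eq_add_right subset_mset.diff_add)
    then show ?thesis by (simp add: finite_splittings)
  qed
  finally show ?thesis .
qed

lemma sum_splittings_empty: "(\<Sum>(u, v)\<in>splittings {#}. h u v) = h {#} {#}"
proof -
  have "splittings {#} = {({#}, {#})}" by (auto simp: splittings_def)
  then show ?thesis by simp
qed

section \<open>Total operations\<close>

text \<open>A series over \<open>coll\<close> is a power series in variables $b_1, b_2, \dots$ with coefficient \<open>op_coeff f w\<close>
  at the monomial $\prod_{k \in w} b_k$. The Cartan formula says that the total operation
  $u \mapsto \sum_w s_w(u)\, b^w$ is a ring homomorphism.\<close>

typedef 'a opseries = "UNIV :: (coll \<Rightarrow> 'a) set"
  morphisms op_coeff Opseries ..

setup_lifting type_definition_opseries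

lemma opseries_eqI: "(\<And>w. op_coeff f w = op_coeff g w) \<Longrightarrow> f = g"
  by (simp add: op_coeff_inject[symmetric] fun_eq_iff)

lemma op_coeff_Opseries [simp]: "op_coeff (Opseries f) = f"
  by (simp add: Opseries_inverse)

instantiation opseries :: (ring_1) ring_1
begin

lift_definition zero_opseries :: "'a opseries" is "\<lambda>w. 0" .
lift_definition one_opseries :: "'a opseries" is "\<lambda>w. if w = {#} then 1 else 0" .
lift_definition plus_opseries :: "'a opseries \<Rightarrow> 'a opseries \<Rightarrow> 'a opseries" is "\<lambda>f g w. f w + g w" .
lift_definition minus_opseries :: "'a opseries \<Rightarrow> 'a opseries \<Rightarrow> 'a opseries" is "\<lambda>f g w. f w - g w" .
lift_definition uminus_opseries :: "'a opseries \<Rightarrow> 'a opseries" is "\<lambda>f w. - f w" .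
lift_definition times_opseries :: "'a opseries \<Rightarrow> 'a opseries \<Rightarrow> 'a opseries"
  is "\<lambda>f g w. \<Sum>(u, v)\<in>splittings w. f u * g v" .

instance
proof
  fix f g h :: "'a opseries"
  show "f * g * h = f * (g * h)"
  proof (transfer, rule ext)
    fix f g h :: "coll \<Rightarrow> 'a" and w
    show "(\<Sum>(u, v)\<in>splittings w. (\<Sum>(u, v)\<in>splittings u. f u * g v) * h v) =
        (\<Sum>(u, v)\<in>splittings w. f u * (\<Sum>(u, v)\<in>splittings v. g u * h v))"
      using sum_splittings_assoc[of "\<lambda>a b c. f a * g b * h c" w]
      by (simp add: sum_distrib_left sum_distrib_right case_prod_beta mult.assoc)
  qed
  show "1 * f = f"
  proof (transfer, rule ext)
    fix f :: "coll \<Rightarrow> 'a" and w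
    have "(\<Sum>(u, v)\<in>splittings w. (if u = {#} then 1 else 0) * f v) =
        (\<Sum>(u, v)\<in>splittings w. if v = {#} then f u else 0)"
      by (subst sum_splittings_commute) (auto intro!: sum.cong)
    then show "(\<Sum>(u, v)\<in>splittings w. (if u = {#} then 1 else 0) * f v) = f w"
      by (simp add: sum_splittings_delta)
  qed
  show "(f + g) * h = f * h + g * h" "f * (g + h) = f * g + f * h"
    by (transfer; simp add: fun_eq_iff case_prod_beta sum.distrib distrib_left distrib_right)+
  show "f * 1 = f"
  proof (transfer, rule ext)
    fix f :: "coll \<Rightarrow> 'a" and w
    have "(\<Sum>(u, v)\<in>splittings w. f u * (if v = {#} then 1 else 0)) =
        (\<Sum>(u, v)\<in>splittings w. if v = {#} then f u else 0)"
      by (auto intro!: sum.cong)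
    then show "(\<Sum>(u, v)\<in>splittings w. f u * (if v = {#} then 1 else 0)) = f w"
      by (simp add: sum_splittings_delta)
  qed
  show "(0::'a opseries) \<noteq> 1" by transfer (metis zero_neq_one)
qed (transfer; simp add: fun_eq_iff)+

end

instance opseries :: (comm_ring_1) comm_ring_1
proof
  fix f g :: "'a opseries"
  show "f * g = g * f"
  proof (transfer, rule ext)
    fix f g :: "coll \<Rightarrow> 'a" and w
    show "(\<Sum>(u, v)\<in>splittings w. f u * g v) = (\<Sum>(u, v)\<in>splittings w. g u * f v)"
      by (subst sum_splittings_commute) (simp add: mult.commute)
  qed
qed (simp_all add: distrib_right)

lemma op_coeff_0 [simp]: "op_coeff 0 w = 0"
  and op_coeff_1: "op_coeff 1 w = (if w = {#} then 1 else 0)"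
  and op_coeff_add [simp]: "op_coeff (f + g) w = op_coeff f w + op_coeff g w"
  and op_coeff_diff [simp]: "op_coeff (f - g) w = op_coeff f w - op_coeff g w"
  and op_coeff_mult: "op_coeff (f * g) w = (\<Sum>(u, v)\<in>splittings w. op_coeff f u * op_coeff g v)"
  by (transfer; simp)+

lemma op_coeff_sum [simp]: "op_coeff (\<Sum>i\<in>I. f i) w = (\<Sum>i\<in>I. op_coeff (f i) w)"
  by (induction I rule: infinite_finite_induct) auto

lemma op_coeff_mult_empty: "op_coeff (f * g) {#} = op_coeff f {#} * op_coeff g {#}"
  by (simp add: op_coeff_mult sum_splittings_empty)

locale unital_ring_hom =
  fixes \<phi> :: "'a::ring_1 \<Rightarrow> 'b::ring_1"
  assumes map_one [simp]: "\<phi> 1 = 1"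
    and map_add [simp]: "\<phi> (x + y) = \<phi> x + \<phi> y"
    and map_mult [simp]: "\<phi> (x * y) = \<phi> x * \<phi> y"
begin

lemma map_zero [simp]: "\<phi> 0 = 0"
  using map_add[of 0 0] by simp

lemma map_uminus [simp]: "\<phi> (- x) = - \<phi> x"
  using map_add[of x "- x"] by (simp add: eq_neg_iff_add_eq_0 add.commute)

lemma map_diff [simp]: "\<phi> (x - y) = \<phi> x - \<phi> y"
  using map_add[of x "- y"] by simp

lemma map_sum: "\<phi> (\<Sum>i\<in>I. f i) = (\<Sum>i\<in>I. \<phi> (f i))"
  by (induction I rule: infinite_finite_induct) auto

lemma map_power [simp]: "\<phi> (x ^ n) = \<phi> x ^ n"
  by (induction n) auto

lemma map_of_nat [simp]: "\<phi> (of_nat n) = of_nat n"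
  by (induction n) auto

lemma map_of_int [simp]: "\<phi> (of_int n) = of_int n"
  by (cases n rule: int_cases2) auto

end

section \<open>Additive extension from a basis\<close>

definition lin_ext :: "('k \<Rightarrow> 'r::ring_1) \<Rightarrow> ('k \<Rightarrow>\<^sub>0 int) \<Rightarrow> 'r" where
  "lin_ext f s = (\<Sum>k\<in>Poly_Mapping.keys s. of_int (Poly_Mapping.lookup s k) * f k)"

lemma lin_ext_superset:
  assumes "finite K" "Poly_Mapping.keys s \<subseteq> K"
  shows "lin_ext f s = (\<Sum>k\<in>K. of_int (Poly_Mapping.lookup s k) * f k)"
  unfolding lin_ext_def
  by (rule sum.mono_neutral_left) (use assms in \<open>auto simp: in_keys_iff\<close>)

lemma lin_ext_add [simp]: "lin_ext f (s + t) = lin_ext f s + lin_ext f t"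
proof -
  let ?K = "Poly_Mapping.keys s \<union> Poly_Mapping.keys t"
  have "Poly_Mapping.keys (s + t) \<subseteq> ?K" by (rule Poly_Mapping.keys_add)
  then show ?thesis
    by (simp add: lin_ext_superset[of ?K] lookup_add distrib_right sum.distrib)
qed

lemma lin_ext_frag_of [simp]: "lin_ext f (frag_of k) = f k"
  by (simp add: lin_ext_def)

lemma lin_ext_one [simp]: "lin_ext f (1 :: 'k multiset \<Rightarrow>\<^sub>0 int) = f {#}"
  unfolding single_one[symmetric] by (simp only: lin_ext_frag_of zero_multiset_def)

lemma additive_zero:
  fixes F :: "'a::ab_group_add \<Rightarrow> 'r::ab_group_add"
  assumes "\<And>s t. F (s + t) = F s + F t"
  shows "F 0 = 0"
  using assms[of 0 0] by simp

lemma additive_diff: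
  fixes F :: "'a::ab_group_add \<Rightarrow> 'r::ab_group_add"
  assumes "\<And>s t. F (s + t) = F s + F t"
  shows "F (s - t) = F s - F t"
  using assms[of "s - t" t] by (simp add: algebra_simps)

lemma additive_eqI:
  fixes F G :: "('k \<Rightarrow>\<^sub>0 int) \<Rightarrow> 'r::ab_group_add"
  assumes F: "\<And>s t. F (s + t) = F s + F t" and G: "\<And>s t. G (s + t) = G s + G t"
    and base: "\<And>k. F (frag_of k) = G (frag_of k)"
  shows "F s = G s"
  using subset_UNIV
proof (induction s rule: frag_induction)
  case zero
  then show ?case by (simp add: additive_zero F G)
next
  case (one k)
  show ?case by (rule base)
next
  case (diff a b)
  then show ?case by (simp add: additive_diff[of F, OF F] additive_diff[of G, OF G])
qed

lemma additive_eq_lin_ext: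
  fixes F :: "('k \<Rightarrow>\<^sub>0 int) \<Rightarrow> 'r::ring_1"
  assumes F: "\<And>s t. F (s + t) = F s + F t"
  shows "F s = lin_ext (\<lambda>k. F (frag_of k)) s"
  by (rule additive_eqI[of F "lin_ext (\<lambda>k. F (frag_of k))"]) (simp_all add: F)

lemma lin_ext_fun_add: "lin_ext (\<lambda>k. f k + g k) s = lin_ext f s + lin_ext g s"
  by (simp add: lin_ext_def distrib_left sum.distrib)

section \<open>Polynomial rings as monoid rings of multisets\<close>

definition poly_eval :: "('i \<Rightarrow> 'r::comm_ring_1) \<Rightarrow> ('i multiset \<Rightarrow>\<^sub>0 int) \<Rightarrow> 'r" where
  "poly_eval h = lin_ext (\<lambda>m. \<Prod>i\<in>#m. h i)"

lemma poly_eval_var [simp]: "poly_eval h (frag_of {#i#}) = h i"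
  by (simp add: poly_eval_def)

lemma poly_eval_hom: "unital_ring_hom (poly_eval h)"
proof
  show "poly_eval h 1 = 1"
    unfolding poly_eval_def by (subst single_one[symmetric], subst lin_ext_frag_of) (simp add: zero_multiset_def[symmetric])
  show add: "poly_eval h (p + q) = poly_eval h p + poly_eval h q" for p q
    by (simp add: poly_eval_def)
  have base: "poly_eval h (frag_of m * frag_of n) = poly_eval h (frag_of m) * poly_eval h (frag_of n)" for m n
    by (simp add: mult_single poly_eval_def)
  have base': "poly_eval h (frag_of m * q) = poly_eval h (frag_of m) * poly_eval h q" for m q
    by (rule additive_eqI[of "\<lambda>q. poly_eval h (frag_of m * q)" "\<lambda>q. poly_eval h (frag_of m) * poly_eval h q" q])
      (simp_all add: distrib_left add base)
  show "poly_eval h (p * q) = poly_eval h p * poly_eval h q" for p q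
    by (rule additive_eqI[of "\<lambda>p. poly_eval h (p * q)" "\<lambda>p. poly_eval h p * poly_eval h q" p])
      (simp_all add: distrib_right add base')
qed

text \<open>Closure under differences yields 0 as 1 - 1 and reaches negative integer
  coefficients.\<close>

lemma monomial_induct [case_names one var mult add diff]:
  fixes p :: "'i multiset \<Rightarrow>\<^sub>0 int"
  assumes "P 1" "\<And>i. P (frag_of {#i#})" "\<And>p q. P p \<Longrightarrow> P q \<Longrightarrow> P (p * q)"
    "\<And>p q. P p \<Longrightarrow> P q \<Longrightarrow> P (p - q)"
  shows "P p"
  using subset_UNIV
proof (induction p rule: frag_induction)
  case zero
  show ?case using assms(4)[OF assms(1) assms(1)] by simp
next
  case (one m)
  show ?case
  proof (induction m)
    case empty
    show ?case using assms(1) by (metis single_one zero_multiset_def)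
  next
    case (add i m)
    have "frag_of (add_mset i m) = frag_of {#i#} * frag_of m" by (simp add: mult_single)
    then show ?case using assms(2,3) add by metis
  qed
next
  case (diff a b)
  then show ?case by (rule assms(4))
qed

section \<open>Cartan actions\<close>

definition total_op :: "(LN \<Rightarrow> 'a::ring_1 \<Rightarrow> 'a) \<Rightarrow> 'a \<Rightarrow> 'a opseries" where
  "total_op A u = Opseries (\<lambda>w. A (s_elem w) u)"

lemma op_coeff_total_op [simp]: "op_coeff (total_op A u) w = A (s_elem w) u"
  by (simp add: total_op_def)

context
  fixes A :: "LN \<Rightarrow> 'a::ring_1 \<Rightarrow> 'a"
  assumes A: "cartan_action A"
begin

lemma cartan_add_left: "A (s + t) u = A s u + A t u"
  and cartan_add: "A s (u + v) = A s u + A s v"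
  and cartan_unit: "A 1 u = u"
  and cartan_mult: "A (s_elem w) (u * v) = (\<Sum>(w', w'')\<in>splittings w. A (s_elem w') u * A (s_elem w'') v)"
  using A by (simp_all add: cartan_action_def flip: single_one)

lemma cartan_zero: "A s 0 = 0"
  by (rule additive_zero[of "A s"]) (simp add: cartan_add)

lemma cartan_diff: "A s (u - v) = A s u - A s v"
  by (rule additive_diff[of "A s"]) (simp add: cartan_add)

lemma cartan_sum: "A s (\<Sum>i\<in>I. f i) = (\<Sum>i\<in>I. A s (f i))"
  by (induction I rule: infinite_finite_induct) (auto simp: cartan_add cartan_zero)

lemma cartan_lin_ext: "A s u = lin_ext (\<lambda>w. A (s_elem w) u) s"
  by (rule additive_eq_lin_ext) (simp add: cartan_add_left)

lemma total_mult: "total_op A (u * v) = total_op A u * total_op A v"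
  by (rule opseries_eqI) (simp add: cartan_mult op_coeff_mult)

text \<open>The total operation of 1 is an idempotent with constant term 1.\<close>

lemma cartan_one: "A (s_elem w) 1 = (if w = {#} then 1 else 0)"
proof (induction "size w" arbitrary: w rule: less_induct)
  case less
  show ?case
  proof (cases "w = {#}")
    case False
    let ?S = "splittings w"
    have sub: "{({#}, w), (w, {#})} \<subseteq> ?S" by (auto simp: splittings_def)
    have "A (s_elem u) 1 * A (s_elem v) 1 = 0" if "(u, v) \<in> ?S - {({#}, w), (w, {#})}" for u v
    proof -
      have "u \<noteq> {#}" "v \<noteq> {#}" "w = u + v" using that by (auto simp: splittings_def)
      then have "size u < size w" using False by (simp add: nonempty_has_size)
      then show ?thesis using less \<open>u \<noteq> {#}\<close> by simp
    qed
    then have "(\<Sum>(u, v)\<in>?S. A (s_elem u) 1 * A (s_elem v) 1) =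
        (\<Sum>(u, v)\<in>{({#}, w), (w, {#})}. A (s_elem u) 1 * A (s_elem v) 1)"
      by (intro sum.mono_neutral_right finite_splittings sub) auto
    \<comment> \<open>Only the two trivial splittings are left, so the coefficient c satisfies c = c
      + c.\<close>
    then have "A (s_elem w) (1 * 1) = A (s_elem w) 1 + A (s_elem w) 1"
      using False by (subst cartan_mult) (simp add: cartan_unit)
    then show ?thesis using False by simp
  qed (simp add: cartan_unit)
qed

lemma total_hom: "unital_ring_hom (total_op A)"
proof
  show "total_op A 1 = 1" by (rule opseries_eqI) (simp add: cartan_one op_coeff_1)
qed (simp_all add: total_mult opseries_eqI cartan_add)

end

lemma cartan_actionI:
  assumes "\<And>s u. A s u = lin_ext (\<lambda>w. A (s_elem w) u) s"
    and "\<And>w u v. A (s_elem w) (u + v) = A (s_elem w) u + A (s_elem w) v"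
    and "\<And>u. A (s_elem {#}) u = u"
    and "\<And>w u v. A (s_elem w) (u * v) = (\<Sum>(w', w'')\<in>splittings w. A (s_elem w') u * A (s_elem w'') v)"
  shows "cartan_action A"
  unfolding cartan_action_def
proof (intro conjI allI)
  fix s t u v
  show "A (s + t) u = A s u + A t u"
    by (subst (1 2 3) assms(1)) simp
  show "A s (u + v) = A s u + A s v"
    by (subst (1 2 3) assms(1)) (simp add: assms(2) lin_ext_fun_add)
qed (rule assms(3,4))+

text \<open>Treats s_empty and the s_(k) alike: for the empty collection the exponent
  \<open>weight w + 1\<close> is 1.\<close>

lemma geometric_operations_weight:
  assumes "cartan_action A"
  shows "geometric_operations A x \<longleftrightarrow>
    (\<forall>w. A (s_elem w) x = (if size w \<le> 1 then x ^ (weight w + 1) else 0))" (is "?l \<longleftrightarrow> ?r")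
proof
  assume l: ?l
  show ?r
  proof
    fix w :: coll
    consider "w = {#}" | k where "w = {#k#}" | "size w > 1"
      by (metis One_nat_def less_one linorder_neqE_nat size_1_singleton_mset size_eq_0_iff_empty)
    then show "A (s_elem w) x = (if size w \<le> 1 then x ^ (weight w + 1) else 0)"
      using l cartan_unit[OF assms] by cases (auto simp: geometric_operations_def)
  qed
next
  assume r: ?r
  then show ?l by (simp add: geometric_operations_def)
qed

text \<open>The coefficient of $b^w$ in $(1 + b_1 + b_2 + \cdots)^i$; for a geometric cobordism element \<open>x\<close> it is
  also the coefficient of $x^{i + |w|}$ in $s_w(x^i)$.\<close>

definition power_coeff :: "nat \<Rightarrow> coll \<Rightarrow> int" where
  "power_coeff i w = op_coeff (Opseries (\<lambda>w. if size w \<le> 1 then 1 else 0) ^ i) w"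

lemma power_coeff_0: "power_coeff 0 w = (if w = {#} then 1 else 0)"
  by (simp add: power_coeff_def op_coeff_1)

lemma power_coeff_Suc:
  "power_coeff (Suc i) w = (\<Sum>(u, v)\<in>splittings w. if size u \<le> 1 then power_coeff i v else 0)"
  unfolding power_coeff_def by (subst power_Suc, subst op_coeff_mult) (auto intro!: sum.cong)

lemma power_coeff_empty [simp]: "power_coeff i {#} = 1"
  by (induction i) (simp_all add: power_coeff_0 power_coeff_Suc sum_splittings_empty)

section \<open>Operations on powers of a geometric cobordism element\<close>

lemma weight_splitting: "(u, v) \<in> splittings w \<Longrightarrow> weight u + weight v = weight w"
  by (auto simp: splittings_def)

lemma geometric_power:
  assumes A: "cartan_action A" and x: "geometric_operations A x"
  shows "A (s_elem w) (x ^ i) = of_int (power_coeff i w) * x ^ (weight w + i)"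
proof (induction i arbitrary: w)
  case 0
  then show ?case by (simp add: cartan_one[OF A] power_coeff_0)
next
  case (Suc i)
  have "A (s_elem w) (x ^ Suc i) =
      (\<Sum>(u, v)\<in>splittings w. A (s_elem u) x * A (s_elem v) (x ^ i))"
    by (simp add: cartan_mult[OF A])
  also have "\<dots> = (\<Sum>(u, v)\<in>splittings w.
      of_int (if size u \<le> 1 then power_coeff i v else 0) * x ^ (weight w + Suc i))"
  proof (rule sum.cong[OF refl], clarify)
    fix u v assume "(u, v) \<in> splittings w"
    then have w: "weight w = weight u + weight v" by (simp add: weight_splitting)
    have "A (s_elem u) x = (if size u \<le> 1 then x ^ (weight u + 1) else 0)"
      using x geometric_operations_weight[OF A] by blast
    \<comment> \<open>The ring may be noncommutative; only integers are moved past powers of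
      \<open>x\<close>.\<close>
    moreover have "x ^ (weight u + 1) * (of_int c * x ^ (weight v + i)) =
        of_int c * x ^ (weight w + Suc i)" for c
    proof -
      have "x ^ (weight u + 1) * (of_int c * x ^ (weight v + i)) =
          of_int c * (x ^ (weight u + 1) * x ^ (weight v + i))"
        by (metis mult.assoc mult_of_int_commute)
      then show ?thesis by (simp only: power_add[symmetric] w) (simp add: algebra_simps)
    qed
    ultimately show "A (s_elem u) x * A (s_elem v) (x ^ i) =
        of_int (if size u \<le> 1 then power_coeff i v else 0) * x ^ (weight w + Suc i)"
      using Suc by simp
  qed
  also have "\<dots> = of_int (power_coeff (Suc i) w) * x ^ (weight w + Suc i)"
    by (simp add: power_coeff_Suc sum_distrib_right case_prod_beta)
  finally show ?case .
qed

text \<open>Since s_v(x^n) is an integer multiple of x^(n + |v|), every term of the Cartan formula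
  keeps the factor x^n. This is the automatic continuity behind the uniqueness of the actions on
  series.\<close>

lemma geometric_power_dvd:
  fixes A :: "LN \<Rightarrow> 'a::comm_ring_1 \<Rightarrow> 'a"
  assumes A: "cartan_action A" and x: "geometric_operations A x"
  shows "x ^ n dvd A s (x ^ n * u)"
proof -
  have "x ^ n dvd A (s_elem w) (x ^ n * u)" for w
    unfolding cartan_mult[OF A] geometric_power[OF A x] power_add
    by (intro dvd_sum) (auto simp: mult.assoc)
  then show ?thesis
    unfolding cartan_lin_ext[OF A, of s] lin_ext_def
    by (intro dvd_sum dvd_mult)
qed

section \<open>Composition of operations\<close>

text \<open>With $y(x) = \sum_k a_k x^{k+1}$ and $a_0 = b_0 = 1$, the composite of the total operations $x \mapsto y(x)$
  and $x \mapsto \sum_k b_k x^{k+1}$ is $x \mapsto \sum_n c_n x^{n+1}$ with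
  $\sum_n c_n x^{n+1} = \sum_k b_k\, y(x)^{k+1}$. The variables \<open>b\<close> belong to the outer index.\<close>

definition comp_gen :: "nat \<Rightarrow> int opseries opseries" where
  "comp_gen n = Opseries (\<lambda>v. Opseries (\<lambda>w.
     if size v \<le> 1 \<and> weight v + weight w = n then power_coeff (weight v + 1) w else 0))"

text \<open>With c_n for \<open>comp_gen n\<close>, the coefficient of a^w b^v in the monomial c^x.
  It will be the coefficient of s_x in s_w s_v, where s_v is applied first and so belongs to the
  outer index.\<close>

definition comp_coeff :: "coll \<Rightarrow> coll \<Rightarrow> coll \<Rightarrow> int" where
  "comp_coeff x w v = op_coeff (op_coeff (\<Prod>k\<in>#x. comp_gen (nat_of_num k)) v) w"

lemma comp_coeff_add:
  "comp_coeff (x + y) w v = (\<Sum>(v', v'')\<in>splittings v. \<Sum>(w', w'')\<in>splittings w.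
     comp_coeff x w' v' * comp_coeff y w'' v'')"
  by (simp add: comp_coeff_def op_coeff_mult case_prod_beta)

lemma comp_gen_0: "comp_gen 0 = 1"
  by (intro opseries_eqI) (auto simp: comp_gen_def op_coeff_1)

lemma comp_coeff_row:
  "comp_coeff (row n) w v =
     (if size v \<le> 1 \<and> weight v + weight w = n then power_coeff (weight v + 1) w else 0)"
proof -
  have "(\<Prod>k\<in>#row n. comp_gen (nat_of_num k)) = comp_gen n"
    by (simp add: row_def comp_gen_0 num_of_nat_inverse)
  then show ?thesis by (simp add: comp_coeff_def comp_gen_def)
qed

lemma comp_coeff_empty: "comp_coeff {#} w v = (if w = {#} \<and> v = {#} then 1 else 0)"
  by (simp add: comp_coeff_def op_coeff_1)

text \<open>Each c_n is homogeneous of weight n when a_k and b_k have weight k. This makes the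
  expansion of s_w s_v finite.\<close>

lemma comp_coeff_weight: "comp_coeff x w v \<noteq> 0 \<Longrightarrow> weight x = weight w + weight v"
proof (induction x arbitrary: w v)
  case empty
  then show ?case by (simp add: comp_coeff_empty split: if_splits)
next
  case (add k x)
  have x: "add_mset k x = row (nat_of_num k) + x" by (simp add: row_def nat_of_num_inverse)
  from add.prems obtain v' v'' w' w'' where
    "(v', v'') \<in> splittings v" "(w', w'') \<in> splittings w"
    "comp_coeff (row (nat_of_num k)) w' v' \<noteq> 0" "comp_coeff x w'' v'' \<noteq> 0"
    unfolding x comp_coeff_add by (auto elim!: sum.not_neutral_contains_not_neutral)
  then show ?case
    using add.IH[of w'' v''] weight_splitting[of v' v'' v] weight_splitting[of w' w'' w]
    by (simp add: comp_coeff_row split: if_splits)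
qed

lemma comp_coeff_eq_0 [simp]: "weight w + weight v < weight x \<Longrightarrow> comp_coeff x w v = 0"
  using comp_coeff_weight[of x w v] by fastforce

text \<open>The coefficient of a^w b^v after substituting c_n for b_n in the series with
  coefficients f; heavier collections cannot contribute. It is used with f x = s_x(u) and with f the
  coordinates of an element of the dual.\<close>

definition comp_sum :: "(coll \<Rightarrow> 'r::comm_ring_1) \<Rightarrow> coll \<Rightarrow> coll \<Rightarrow> 'r" where
  "comp_sum f w v = (\<Sum>x | weight x \<le> weight w + weight v. of_int (comp_coeff x w v) * f x)"

lemma comp_sum_bound:
  assumes "weight w + weight v \<le> n"
  shows "comp_sum f w v = (\<Sum>x | weight x \<le> n. of_int (comp_coeff x w v) * f x)"
  unfolding comp_sum_def
  by (rule sum.mono_neutral_left)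
    (use assms in \<open>auto simp: finite_weight_le not_le\<close>)

text \<open>Substituting c_n for b_n is multiplicative, and the argument on the left is the
  coefficient function of a product in \<open>opseries\<close>. This one identity gives the Cartan
  formula both for composite operations and for \<open>R_star\<close>.\<close>

lemma comp_sum_mult:
  fixes f g :: "coll \<Rightarrow> 'r::comm_ring_1"
  shows "comp_sum (\<lambda>x. \<Sum>(y, z)\<in>splittings x. f y * g z) w v =
    (\<Sum>(v', v'')\<in>splittings v. \<Sum>(w', w'')\<in>splittings w. comp_sum f w' v' * comp_sum g w'' v'')"
    (is "?l = ?r")
proof -
  define n where "n = weight w + weight v"
  define W where "W = {x. weight x \<le> n}"
  have W: "finite W" by (simp add: W_def finite_weight_le)
  have "?l = (\<Sum>x\<in>W. \<Sum>p\<in>splittings x. of_int (comp_coeff x w v) * (f (fst p) * g (snd p)))"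
    by (simp add: comp_sum_def n_def W_def sum_distrib_left case_prod_beta)
  also have "\<dots> = (\<Sum>(x, p)\<in>Sigma W splittings.
      of_int (comp_coeff (fst p + snd p) w v) * (f (fst p) * g (snd p)))"
    by (subst sum.Sigma) (auto simp: W finite_splittings, auto simp: splittings_def intro!: sum.cong)
  also have "\<dots> = (\<Sum>p\<in>{p \<in> W \<times> W. weight (fst p) + weight (snd p) \<le> n}.
      of_int (comp_coeff (fst p + snd p) w v) * (f (fst p) * g (snd p)))"
    by (rule sum.reindex_bij_witness[where j = snd and i = "\<lambda>p. (fst p + snd p, p)"])
      (auto simp: W_def splittings_def)
  \<comment> \<open>Pairs of larger total weight have vanishing structure constants. Adding them
    makes the index set a product, so that the sum factors below.\<close>
  also have "\<dots> = (\<Sum>p\<in>W \<times> W. of_int (comp_coeff (fst p + snd p) w v) * (f (fst p) * g (snd p)))"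
    by (rule sum.mono_neutral_left)
      (auto simp: W n_def not_le)
  also have "\<dots> = (\<Sum>p\<in>W \<times> W. \<Sum>(v', v'')\<in>splittings v. \<Sum>(w', w'')\<in>splittings w.
      of_int (comp_coeff (fst p) w' v') * f (fst p) * (of_int (comp_coeff (snd p) w'' v'') * g (snd p)))"
    by (simp add: comp_coeff_add case_prod_beta sum_distrib_left sum_distrib_right mult_ac)
  also have "\<dots> = (\<Sum>(v', v'')\<in>splittings v. \<Sum>(w', w'')\<in>splittings w. \<Sum>p\<in>W \<times> W.
      of_int (comp_coeff (fst p) w' v') * f (fst p) * (of_int (comp_coeff (snd p) w'' v'') * g (snd p)))"
    by (simp add: case_prod_beta sum.swap[where A = "W \<times> W"])
  also have "\<dots> = ?r"
  proof (intro sum.cong[OF refl], clarify, intro sum.cong[OF refl], clarify)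
    fix v' v'' w' w''
    assume "(v', v'') \<in> splittings v" "(w', w'') \<in> splittings w"
    then have le: "weight w' + weight v' \<le> n" "weight w'' + weight v'' \<le> n"
      by (auto simp: n_def splittings_def)
    show "(\<Sum>p\<in>W \<times> W. of_int (comp_coeff (fst p) w' v') * f (fst p) *
          (of_int (comp_coeff (snd p) w'' v'') * g (snd p))) =
        comp_sum f w' v' * comp_sum g w'' v''"
      unfolding comp_sum_bound[OF le(1)] comp_sum_bound[OF le(2)] sum_product W_def
      by (simp add: sum.cartesian_product case_prod_beta)
  qed
  finally show ?thesis .
qed

section \<open>The expected product of two basis elements\<close>

definition comp_elem :: "coll \<Rightarrow> coll \<Rightarrow> LN" where
  "comp_elem w v = (\<Sum>x | weight x \<le> weight w + weight v. frag_cmul (comp_coeff x w v) (s_elem x))"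

lemma lookup_comp_elem: "Poly_Mapping.lookup (comp_elem w v) x = comp_coeff x w v"
proof -
  have "Poly_Mapping.lookup (comp_elem w v) x =
      (\<Sum>y | weight y \<le> weight w + weight v. if y = x then comp_coeff x w v else 0)"
    unfolding comp_elem_def lookup_sum by (rule sum.cong) auto
  also have "\<dots> = comp_coeff x w v"
    by (auto simp: finite_weight_le not_le)
  finally show ?thesis .
qed

lemma lin_ext_comp_elem: "lin_ext f (comp_elem w v) = comp_sum f w v"
proof -
  have "lin_ext f (comp_elem w v) =
      (\<Sum>x | weight x \<le> weight w + weight v. of_int (comp_coeff x w v) * f x)"
    by (subst lin_ext_superset[where K = "{x. weight x \<le> weight w + weight v}"])
      (auto simp: finite_weight_le lookup_comp_elem in_keys_iff intro: leI)
  then show ?thesis by (simp add: comp_sum_def)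
qed

text \<open>A property of a single element \<open>u\<close>, so that it can be checked on generators
  and carried to sums, products and adic limits.\<close>

definition composes :: "(LN \<Rightarrow> 'a::ring_1 \<Rightarrow> 'a) \<Rightarrow> 'a \<Rightarrow> bool" where
  "composes A u \<longleftrightarrow> (\<forall>w v. A (comp_elem w v) u = A (s_elem w) (A (s_elem v) u))"

context
  fixes A :: "LN \<Rightarrow> 'a::comm_ring_1 \<Rightarrow> 'a"
  assumes A: "cartan_action A"
begin

lemma action_comp_elem: "A (comp_elem w v) u = comp_sum (\<lambda>x. A (s_elem x) u) w v"
  by (subst cartan_lin_ext[OF A]) (rule lin_ext_comp_elem)

lemma composes_add: "composes A u \<Longrightarrow> composes A v \<Longrightarrow> composes A (u + v)"
  and composes_diff: "composes A u \<Longrightarrow> composes A v \<Longrightarrow> composes A (u - v)"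
  by (simp_all add: composes_def cartan_add[OF A] cartan_diff[OF A])

lemma composes_one: "composes A 1"
  unfolding composes_def
proof (intro allI)
  fix w v
  have "A (comp_elem w v) 1 =
      (\<Sum>x | weight x \<le> weight w + weight v. if x = {#} then of_int (comp_coeff {#} w v) else 0)"
    unfolding action_comp_elem comp_sum_def by (rule sum.cong) (auto simp: cartan_one[OF A])
  then show "A (comp_elem w v) 1 = A (s_elem w) (A (s_elem v) 1)"
    by (simp add: finite_weight_le comp_coeff_empty cartan_one[OF A] cartan_zero[OF A])
qed

lemma composes_mult:
  assumes "composes A u" "composes A v"
  shows "composes A (u * v)"
  unfolding composes_def
proof (intro allI)
  fix w z
  have "A (s_elem w) (A (s_elem z) (u * v)) = (\<Sum>(z', z'')\<in>splittings z. \<Sum>(w', w'')\<in>splittings w.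
      A (s_elem w') (A (s_elem z') u) * A (s_elem w'') (A (s_elem z'') v))"
    by (simp add: cartan_mult[OF A] cartan_sum[OF A] case_prod_beta)
  also have "\<dots> = A (comp_elem w z) (u * v)"
    unfolding action_comp_elem cartan_mult[OF A] comp_sum_mult
    using assms by (simp add: composes_def action_comp_elem)
  finally show "A (comp_elem w z) (u * v) = A (s_elem w) (A (s_elem z) (u * v))" ..
qed

text \<open>The case for which \<open>comp_gen\<close> was designed: s_w(x^(|v|+1)) has coefficient
  \<open>power_coeff (weight v + 1) w\<close>, and by weight only \<open>row ?n\<close> can
  contribute among the s_z.\<close>

lemma composes_geometric:
  assumes x: "geometric_operations A x"
  shows "composes A x"
  unfolding composes_def
proof (intro allI)
  fix w v
  note sx = x[unfolded geometric_operations_weight[OF A], rule_format]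
  let ?n = "weight w + weight v"
  have "A (comp_elem w v) x =
      (\<Sum>z | weight z \<le> ?n. if z = row ?n then of_int (comp_coeff (row ?n) w v) * x ^ (?n + 1) else 0)"
    unfolding action_comp_elem comp_sum_def
  proof (rule sum.cong[OF refl])
    fix z
    show "of_int (comp_coeff z w v) * A (s_elem z) x =
        (if z = row ?n then of_int (comp_coeff (row ?n) w v) * x ^ (?n + 1) else 0)"
    proof (cases "comp_coeff z w v = 0")
      case False
      then have "size z \<le> 1 \<longleftrightarrow> z = row ?n" by (metis comp_coeff_weight size_le_1_iff_row)
      then show ?thesis by (auto simp: sx)
    qed auto
  qed
  also have "\<dots> = of_int (comp_coeff (row ?n) w v) * x ^ (?n + 1)"
    by (simp add: finite_weight_le)
  also have "\<dots> = A (s_elem w) (A (s_elem v) x)"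
    by (simp add: comp_coeff_row sx[of v] geometric_power[OF A x] cartan_zero[OF A] algebra_simps
        del: power_Suc)
  finally show "A (comp_elem w v) x = A (s_elem w) (A (s_elem v) x)" .
qed

text \<open>Both composites preserve divisibility by powers of x, so the defect for \<open>z\<close>
  is divisible by every x^n and vanishes.\<close>

lemma composes_limit:
  assumes x: "geometric_operations A x"
    and sep: "\<And>d. (\<And>n. x ^ n dvd d) \<Longrightarrow> d = 0"
    and lim: "\<And>n. \<exists>u r. composes A u \<and> z = u + x ^ n * r"
  shows "composes A z"
  unfolding composes_def
proof (intro allI)
  fix w v
  have "A (comp_elem w v) z - A (s_elem w) (A (s_elem v) z) = 0"
  proof (rule sep)
    fix n
    obtain u r where u: "composes A u" and z: "z = u + x ^ n * r" using lim by blast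
    obtain q where "A (s_elem v) (x ^ n * r) = x ^ n * q"
      using geometric_power_dvd[OF A x] by (meson dvdE)
    then have "x ^ n dvd A (s_elem w) (A (s_elem v) (x ^ n * r))"
      using geometric_power_dvd[OF A x] by simp
    moreover have "x ^ n dvd A (comp_elem w v) (x ^ n * r)"
      by (rule geometric_power_dvd[OF A x])
    moreover have "A (comp_elem w v) z - A (s_elem w) (A (s_elem v) z) =
        A (comp_elem w v) (x ^ n * r) - A (s_elem w) (A (s_elem v) (x ^ n * r))"
      using u by (simp add: z cartan_add[OF A] composes_def)
    ultimately show "x ^ n dvd A (comp_elem w v) z - A (s_elem w) (A (s_elem v) z)"
      by simp
  qed
  then show "A (comp_elem w v) z = A (s_elem w) (A (s_elem v) z)" by simp
qed

end

definition comp_prod :: "LN \<Rightarrow> LN \<Rightarrow> LN" where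
  "comp_prod s t = frag_extend (\<lambda>w. frag_extend (comp_elem w) t) s"

lemma comp_prod_s_elem [simp]: "comp_prod (s_elem w) (s_elem v) = comp_elem w v"
  and comp_prod_add_left: "comp_prod (s + s') t = comp_prod s t + comp_prod s' t"
  by (simp_all add: comp_prod_def frag_extend_add)

lemma comp_prod_add_right: "comp_prod s (t + t') = comp_prod s t + comp_prod s t'"
  by (rule additive_eqI[of "\<lambda>s. comp_prod s (t + t')" "\<lambda>s. comp_prod s t + comp_prod s t'"])
    (simp_all add: comp_prod_add_left, simp add: comp_prod_def frag_extend_add)

lemma composes_comp_prod:
  assumes A: "cartan_action A" and u: "composes A u"
  shows "A (comp_prod s t) u = A s (A t u)"
proof -
  have base: "A (comp_prod (s_elem w) t) u = A (s_elem w) (A t u)" for w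
    by (rule additive_eqI[of "\<lambda>t. A (comp_prod (s_elem w) t) u" "\<lambda>t. A (s_elem w) (A t u)"])
      (use u in \<open>simp_all add: comp_prod_add_right cartan_add_left[OF A] cartan_add[OF A] composes_def\<close>)
  show ?thesis
    by (rule additive_eqI[of "\<lambda>s. A (comp_prod s t) u" "\<lambda>s. A s (A t u)"])
      (simp_all add: comp_prod_add_left cartan_add_left[OF A] base)
qed

section \<open>The product of the Landweber--Novikov algebra\<close>

definition geometric_total :: "'a::ring_1 \<Rightarrow> 'a opseries" where
  "geometric_total x = Opseries (\<lambda>w. if size w \<le> 1 then x ^ (weight w + 1) else 0)"

lemma geometric_operations_total:
  "cartan_action A \<Longrightarrow> geometric_operations A x \<longleftrightarrow> total_op A x = geometric_total x"
  by (auto simp: geometric_operations_weight total_op_def geometric_total_def Opseries_inject fun_eq_iff)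

lemma cartan_eqI:
  assumes "cartan_action A" "cartan_action A'" "\<And>u. total_op A u = total_op A' u"
  shows "A = A'"
proof (intro ext)
  fix s u
  have "A (s_elem w) u = A' (s_elem w) u" for w
    using assms(3)[of u] by (metis op_coeff_total_op)
  then show "A s u = A' s u"
    by (simp add: cartan_lin_ext[OF assms(1), of s] cartan_lin_ext[OF assms(2), of s])
qed

definition ypoly_total :: "ypoly \<Rightarrow> ypoly opseries" where
  "ypoly_total = poly_eval (\<lambda>j. geometric_total (y_var j))"

interpretation ypoly_total: unital_ring_hom ypoly_total
  unfolding ypoly_total_def by (rule poly_eval_hom)

lemma ypoly_total_y_var [simp]: "ypoly_total (y_var j) = geometric_total (y_var j)"
  by (simp add: ypoly_total_def y_var_def)

lemma op_coeff_ypoly_total_empty: "op_coeff (ypoly_total p) {#} = p"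
  by (induction p rule: monomial_induct)
    (simp_all add: op_coeff_1 op_coeff_mult_empty geometric_total_def flip: y_var_def)

lemma cartan_eq_ypoly_total:
  assumes A: "cartan_action A" and y: "\<And>j. geometric_operations A (y_var j)"
  shows "total_op A p = ypoly_total p"
proof -
  interpret unital_ring_hom "total_op A" by (rule total_hom[OF A])
  show ?thesis
  proof (induction p rule: monomial_induct)
    case (var j)
    then show ?case
      using y[of j] geometric_operations_total[OF A] by (simp flip: y_var_def)
  qed simp_all
qed

text \<open>Multiplicativity of \<open>ypoly_total\<close> makes its coefficients an action. Any
  competitor has the same total operation, because a ring homomorphism is determined by the images
  of the variables.\<close>

lemma
  shows cartan_ypoly_act: "cartan_action ypoly_act"
    and geometric_ypoly_act: "geometric_operations ypoly_act (y_var j)"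
    and total_ypoly_act: "total_op ypoly_act p = ypoly_total p"
proof -
  let ?A = "\<lambda>s p. lin_ext (op_coeff (ypoly_total p)) s"
  have A: "cartan_action ?A"
    by (rule cartan_actionI) (simp_all add: op_coeff_ypoly_total_empty op_coeff_mult)
  have total: "total_op ?A = ypoly_total"
    by (simp add: total_op_def op_coeff_inverse fun_eq_iff)
  have y: "geometric_operations ?A (y_var j)" for j
    by (simp add: geometric_operations_total[OF A] total)
  have "ypoly_act = ?A"
    unfolding ypoly_act_def
  proof (rule the_equality)
    fix A assume "cartan_action A \<and> (\<forall>j. geometric_operations A (y_var j))"
    then show "A = ?A"
      using A by (intro cartan_eqI) (simp_all add: cartan_eq_ypoly_total total)
  qed (use A y in auto)
  then show "cartan_action ypoly_act" "geometric_operations ypoly_act (y_var j)"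
    "total_op ypoly_act p = ypoly_total p"
    using A y total by simp_all
qed

lemma composes_ypoly_act: "composes ypoly_act p"
proof (induction p rule: monomial_induct)
  case one
  show ?case by (rule composes_one[OF cartan_ypoly_act])
next
  case (var j)
  show ?case
    unfolding y_var_def[symmetric] by (rule composes_geometric[OF cartan_ypoly_act geometric_ypoly_act])
qed (simp_all add: composes_mult composes_diff cartan_ypoly_act)

section \<open>Faithfulness of the action on polynomials\<close>

lemma lookup_mult_frag_of:
  "Poly_Mapping.lookup (p * frag_of m) k = (if m \<subseteq># k then Poly_Mapping.lookup p (k - m) else 0)"
  by (rule additive_eqI[of "\<lambda>p. Poly_Mapping.lookup (p * frag_of m) k"
        "\<lambda>p. if m \<subseteq># k then Poly_Mapping.lookup p (k - m) else 0"])
    (auto simp: distrib_right lookup_add mult_single)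

lemma y_var_power: "y_var j ^ n = frag_of (replicate_mset n j)"
proof (induction n)
  case (Suc n)
  then show ?case by (simp add: y_var_def mult_single)
qed (simp flip: single_one zero_multiset_def)

text \<open>The coefficient of $\prod_j y_j^{e_j + 1}$ in $s_w(y_0 \cdots y_{n-1})$ detects whether \<open>w\<close> consists of
  the nonzero $e_j$.\<close>

lemma lookup_ypoly_total_prod:
  "Poly_Mapping.lookup (op_coeff (ypoly_total (\<Prod>j<n. y_var j)) w) m \<noteq> 0 \<Longrightarrow> set_mset m \<subseteq> {..<n}"
  "Poly_Mapping.lookup (op_coeff (ypoly_total (\<Prod>j<n. y_var j)) w) (\<Sum>j<n. replicate_mset (e j + 1) j) =
     (if w = (\<Sum>j<n. row (e j)) then 1 else 0)"
proof (induction n arbitrary: w m)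
  case 0
  {
    case 1
    then show ?case
      by (auto simp: op_coeff_1 lookup_one zero_multiset_def split: if_splits)
  next
    case 2
    then show ?case
      by (auto simp: op_coeff_1 lookup_one)
  }
next
  case (Suc n)
  let ?q = "\<lambda>u. op_coeff (ypoly_total (\<Prod>j<n. y_var j)) u"
  have coeff: "Poly_Mapping.lookup (op_coeff (ypoly_total (\<Prod>j<Suc n. y_var j)) w) m =
      (\<Sum>(u, v)\<in>splittings w. if size v \<le> 1 \<and> replicate_mset (weight v + 1) n \<subseteq># m
        then Poly_Mapping.lookup (?q u) (m - replicate_mset (weight v + 1) n) else 0)" for w m
    by (auto simp: op_coeff_mult lookup_sum geometric_total_def y_var_power lookup_mult_frag_of
        simp del: power_Suc replicate_mset_Suc intro!: sum.cong)
  {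
    case 1
    then obtain u v where sub: "replicate_mset (weight v + 1) n \<subseteq># m"
      and "Poly_Mapping.lookup (?q u) (m - replicate_mset (weight v + 1) n) \<noteq> 0"
      unfolding coeff by (auto elim!: sum.not_neutral_contains_not_neutral split: if_splits)
    then have "set_mset (m - replicate_mset (weight v + 1) n) \<subseteq> {..<n}"
      by (intro Suc.IH(1))
    moreover have "set_mset m =
        set_mset (m - replicate_mset (weight v + 1) n) \<union> set_mset (replicate_mset (weight v + 1) n)"
      using subset_mset.diff_add[OF sub] by (metis set_mset_union)
    ultimately show ?case
      by (auto simp: less_Suc_eq)
  next
    case 2
    let ?M = "\<Sum>j<n. replicate_mset (e j + 1) j"
    let ?m = "?M + replicate_mset (e n + 1) n"
    have n: "count ?M n = 0" by (simp add: count_sum)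
    \<comment> \<open>The product over j < n contributes no y_n, so the exponent e_n + 1 of y_n
      comes from the last factor alone, which forces \<open>weight v = e n\<close>.\<close>
    have "(if size v \<le> 1 \<and> replicate_mset (weight v + 1) n \<subseteq># ?m
        then Poly_Mapping.lookup (?q u) (?m - replicate_mset (weight v + 1) n) else 0) =
        (if v = row (e n) then Poly_Mapping.lookup (?q u) ?M else 0)" for u v
    proof (cases "weight v = e n")
      case True
      then show ?thesis
        using size_le_1_iff_row[of v] by auto
    next
      case False
      have "Poly_Mapping.lookup (?q u) (?m - replicate_mset (weight v + 1) n) = 0"
        if "replicate_mset (weight v + 1) n \<subseteq># ?m"
      proof (rule ccontr)
        assume "Poly_Mapping.lookup (?q u) (?m - replicate_mset (weight v + 1) n) \<noteq> 0"
        then have "count (?m - replicate_mset (weight v + 1) n) n = 0"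
          using Suc.IH(1) by (meson count_eq_zero_iff lessThan_iff less_irrefl subsetD)
        moreover have "weight v + 1 \<le> e n + 1"
          using mset_subset_eq_count[OF that, of n] n by simp
        ultimately show False using n False by simp
      qed
      then show ?thesis using False by auto
    qed
    then have "Poly_Mapping.lookup (op_coeff (ypoly_total (\<Prod>j<Suc n. y_var j)) w) ?m =
        (\<Sum>(u, v)\<in>splittings w. if v = row (e n) then Poly_Mapping.lookup (?q u) ?M else 0)"
      unfolding coeff by simp
    also have "\<dots> = (if w = (\<Sum>j<Suc n. row (e j)) then 1 else 0)"
      unfolding sum_splittings_delta Suc.IH(2) by (auto, metis subset_mset.diff_add)
    finally show ?case by simp
  }
qed

lemma coll_eq_sum_row: "\<exists>(n::nat) e. w = (\<Sum>j<n. row (e j))"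
proof (induction w)
  case empty
  show ?case by (rule exI[of _ 0]) simp
next
  case (add k w)
  then obtain n :: nat and e where w: "w = (\<Sum>j<n. row (e j))" by blast
  have "add_mset k w = (\<Sum>j<Suc n. row ((e(n := nat_of_num k)) j))"
    by (simp add: w) (simp add: row_def nat_of_num_inverse)
  then show ?case by blast
qed

lemma lookup_lin_ext: "Poly_Mapping.lookup (lin_ext f s) k = lin_ext (\<lambda>w. Poly_Mapping.lookup (f w) k) s"
  by (rule additive_eqI[of "\<lambda>s. Poly_Mapping.lookup (lin_ext f s) k"
        "\<lambda>s. lin_ext (\<lambda>w. Poly_Mapping.lookup (f w) k) s"]) (simp_all add: lookup_add)

lemma lin_ext_delta: "lin_ext (\<lambda>w. if w = a then 1 else 0) s = (Poly_Mapping.lookup s a :: int)"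
  by (rule additive_eqI[of "lin_ext (\<lambda>w. if w = a then 1 else 0)" "\<lambda>s. Poly_Mapping.lookup s a"])
    (simp_all add: lookup_add)

text \<open>For each w, a suitable monomial in the image of y_0 ... y_{n-1} has the coordinate of
  the operation at w as its coefficient.\<close>

lemma ypoly_act_faithful:
  assumes "\<And>p. ypoly_act s p = ypoly_act t p"
  shows "s = t"
proof (rule poly_mapping_eqI)
  fix w :: coll
  obtain n :: nat and e where w: "w = (\<Sum>j<n. row (e j))" using coll_eq_sum_row by blast
  have "Poly_Mapping.lookup (ypoly_act u (\<Prod>j<n. y_var j)) (\<Sum>j<n. replicate_mset (e j + 1) j) =
      Poly_Mapping.lookup u w" for u
  proof -
    have "ypoly_act u (\<Prod>j<n. y_var j) = lin_ext (op_coeff (ypoly_total (\<Prod>j<n. y_var j))) u"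
      unfolding total_ypoly_act[symmetric] by (simp add: cartan_lin_ext[OF cartan_ypoly_act, of u] total_op_def)
    then show ?thesis
      by (simp only: lookup_lin_ext lookup_ypoly_total_prod(2) w[symmetric] lin_ext_delta)
  qed
  then show "Poly_Mapping.lookup s w = Poly_Mapping.lookup t w" using assms by metis
qed

lemma ypoly_act_comp_prod: "ypoly_act (comp_prod s t) p = ypoly_act s (ypoly_act t p)"
  by (rule composes_comp_prod[OF cartan_ypoly_act composes_ypoly_act])

lemma LN_times_eq: "LN_times s t = comp_prod s t"
  unfolding LN_times_def
  by (rule the_equality) (auto simp: ypoly_act_comp_prod intro: ypoly_act_faithful)

text \<open>Inherited from composition of maps through faithfulness, without manipulating structure
  constants.\<close>

lemma comp_prod_assoc: "comp_prod (comp_prod s t) u = comp_prod s (comp_prod t u)"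
  by (rule ypoly_act_faithful) (simp add: ypoly_act_comp_prod)

lemma comp_prod_unit: "comp_prod s 1 = s"
  by (rule ypoly_act_faithful) (simp add: ypoly_act_comp_prod cartan_unit[OF cartan_ypoly_act])

lemma milnor_module_iff_composes: "milnor_module A \<longleftrightarrow> cartan_action A \<and> (\<forall>u. composes A u)"
proof
  assume "milnor_module A"
  then show "cartan_action A \<and> (\<forall>u. composes A u)"
    unfolding milnor_module_def composes_def LN_times_eq by (metis comp_prod_s_elem)
next
  assume "cartan_action A \<and> (\<forall>u. composes A u)"
  then show "milnor_module A"
    by (simp add: milnor_module_def LN_times_eq composes_comp_prod)
qed

section \<open>The action on the dual\<close>

lemma pairing_lin_ext: "pairing l s = lin_ext (Poly_Mapping.lookup l) s"
  by (simp add: pairing_def lin_ext_def mult.commute)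

text \<open>The transpose of right multiplication by s_v, with the structure constants read in the
  other direction. The bound on \<open>weight w\<close> discards only terms that vanish by
  homogeneity.\<close>

definition dual_op :: "coll \<Rightarrow> LNdual \<Rightarrow> LNdual" where
  "dual_op v = frag_extend (\<lambda>x. \<Sum>w | weight w \<le> weight x. frag_cmul (comp_coeff x w v) (frag_of w))"

lemma comp_sum_lookup_frag_of: "comp_sum (Poly_Mapping.lookup (frag_of x)) w v = comp_coeff x w v"
proof -
  have "comp_sum (Poly_Mapping.lookup (frag_of x)) w v =
      (\<Sum>z | weight z \<le> weight w + weight v. if z = x then comp_coeff x w v else 0)"
    unfolding comp_sum_def by (rule sum.cong) auto
  then show ?thesis by (simp add: finite_weight_le not_le)
qed

lemma lookup_dual_op: "Poly_Mapping.lookup (dual_op v l) w = comp_sum (Poly_Mapping.lookup l) w v"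
proof (rule additive_eqI[of "\<lambda>l. Poly_Mapping.lookup (dual_op v l) w"
      "\<lambda>l. comp_sum (Poly_Mapping.lookup l) w v"])
  fix x
  have "Poly_Mapping.lookup (dual_op v (frag_of x)) w =
      (\<Sum>z | weight z \<le> weight x. if z = w then comp_coeff x w v else 0)"
    unfolding dual_op_def frag_extend_of lookup_sum by (rule sum.cong) auto
  also have "\<dots> = comp_coeff x w v"
    using comp_coeff_weight[of x w v] by (cases "comp_coeff x w v = 0") (simp_all add: finite_weight_le)
  finally show "Poly_Mapping.lookup (dual_op v (frag_of x)) w = comp_sum (Poly_Mapping.lookup (frag_of x)) w v"
    by (simp only: comp_sum_lookup_frag_of)
qed (simp_all add: dual_op_def frag_extend_add lookup_add comp_sum_def distrib_left sum.distrib)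

lemma pairing_dual_op: "pairing (frag_extend (\<lambda>v. dual_op v l) s) t = pairing l (comp_prod t s)"
    (is "pairing (?R s) t = _")
proof -
  have pairing_add: "pairing (l + m) t = pairing l t + pairing m t" for l m t
    by (simp add: pairing_lin_ext lin_ext_def lookup_add distrib_left sum.distrib)
  have base: "pairing (?R (s_elem v)) t = pairing l (comp_prod t (s_elem v))" for v
    by (rule additive_eqI[of "\<lambda>t. pairing (?R (s_elem v)) t" "\<lambda>t. pairing l (comp_prod t (s_elem v))"])
      (simp_all add: pairing_lin_ext comp_prod_add_left lin_ext_comp_elem lookup_dual_op)
  show ?thesis
    by (rule additive_eqI[of "\<lambda>s. pairing (?R s) t" "\<lambda>s. pairing l (comp_prod t s)"])
      (simp_all only: base frag_extend_add pairing_add comp_prod_add_right, simp add: pairing_lin_ext)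
qed

lemma dual_eqI: "(\<And>t. pairing l t = pairing m t) \<Longrightarrow> l = m"
  by (metis pairing_s_elem poly_mapping_eqI)

lemma R_star_eq: "R_star s l = frag_extend (\<lambda>v. dual_op v l) s"
  unfolding R_star_def by (rule the_equality) (auto intro: dual_eqI simp: pairing_dual_op LN_times_eq)

lemma pairing_R_star: "pairing (R_star s l) t = pairing l (comp_prod t s)"
  by (simp add: R_star_eq pairing_dual_op)

lemma lookup_R_star: "Poly_Mapping.lookup (R_star (s_elem v) l) w = comp_sum (Poly_Mapping.lookup l) w v"
  by (simp add: R_star_eq lookup_dual_op)

lemma lookup_times_dual:
  fixes l m :: LNdual
  shows "Poly_Mapping.lookup (l * m) x =
    (\<Sum>(y, z)\<in>splittings x. Poly_Mapping.lookup l y * Poly_Mapping.lookup m z)"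
  using pairing_times[of l m x] by (simp add: pairing_s_elem)

lemma milnor_module_R_star: "milnor_module R_star"
  unfolding milnor_module_def
proof
  show "cartan_action R_star"
  proof (rule cartan_actionI)
    show "R_star s u = lin_ext (\<lambda>w. R_star (s_elem w) u) s" for s u
      by (rule additive_eq_lin_ext) (simp add: R_star_eq frag_extend_add)
    show "R_star (s_elem w) (u + v) = R_star (s_elem w) u + R_star (s_elem w) v" for w u v
      by (simp add: R_star_eq dual_op_def frag_extend_add)
    show "R_star (s_elem {#}) u = u" for u
      by (rule dual_eqI) (simp add: pairing_R_star comp_prod_unit)
    show "R_star (s_elem w) (u * v) =
        (\<Sum>(w', w'')\<in>splittings w. R_star (s_elem w') u * R_star (s_elem w'') v)" for w u v
    proof (rule poly_mapping_eqI)
      fix x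
      \<comment> \<open>Multiplication in the dual is convolution over splittings, so
        \<open>comp_sum_mult\<close> applies to the coordinates of \<open>u * v\<close>.\<close>
      have "Poly_Mapping.lookup (R_star (s_elem w) (u * v)) x =
          (\<Sum>(w', w'')\<in>splittings w. \<Sum>(x', x'')\<in>splittings x.
            comp_sum (Poly_Mapping.lookup u) x' w' * comp_sum (Poly_Mapping.lookup v) x'' w'')"
        by (simp only: lookup_R_star lookup_times_dual[abs_def] comp_sum_mult)
      then show "Poly_Mapping.lookup (R_star (s_elem w) (u * v)) x = Poly_Mapping.lookup
          (\<Sum>(w', w'')\<in>splittings w. R_star (s_elem w') u * R_star (s_elem w'') v) x"
        by (simp add: lookup_sum lookup_times_dual lookup_R_star case_prod_beta)
    qed
  qed
  show "\<forall>s t u. R_star (LN_times s t) u = R_star s (R_star t u)"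
    by (auto intro!: dual_eqI simp: LN_times_eq pairing_R_star comp_prod_assoc)
qed

section \<open>Values of power series in filtered algebras\<close>

locale filtered_ring =
  fixes J :: "nat \<Rightarrow> 'r::ring_1 set"
  assumes J_0: "J 0 = UNIV"
    and J_Suc: "J (Suc n) \<subseteq> J n"
    and J_Inter: "(\<Inter>n. J n) = {0}"
    and J_diff: "u \<in> J n \<Longrightarrow> v \<in> J n \<Longrightarrow> u - v \<in> J n"
    and J_mult: "u \<in> J m \<Longrightarrow> v \<in> J n \<Longrightarrow> u * v \<in> J (m + n)"
begin

lemma J_zero: "0 \<in> J n"
  using J_Inter by blast

lemma J_add: "u \<in> J n \<Longrightarrow> v \<in> J n \<Longrightarrow> u + v \<in> J n"
  using J_diff[of u n "0 - v"] J_diff[OF J_zero, of v n] by simp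

lemma J_sum: "(\<And>i. i \<in> I \<Longrightarrow> f i \<in> J n) \<Longrightarrow> (\<Sum>i\<in>I. f i) \<in> J n"
  by (induction I rule: infinite_finite_induct) (auto simp: J_zero J_add)

lemma J_mono: "m \<le> n \<Longrightarrow> J n \<subseteq> J m"
  by (rule lift_Suc_antimono_le[of J]) (use J_Suc in auto)

lemma J_mult_left: "u \<in> J n \<Longrightarrow> r * u \<in> J n"
  using J_mult[of r 0 u n] by (simp add: J_0)

lemma J_power: "x \<in> J 1 \<Longrightarrow> x ^ n \<in> J n"
proof (induction n)
  case (Suc n)
  then show ?case using J_mult[of x 1 "x ^ n" n] by simp
qed (simp add: J_0)

lemma J_eqI: "(\<And>n. u - v \<in> J n) \<Longrightarrow> u = v"
  using J_Inter by (metis INT_I UNIV_I right_minus_eq singletonD)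

end

text \<open>Evaluation is a relation, since the filtration is only Hausdorff: values are unique but
  need not exist. The instances are one-variable series with the X-adic filtration and two-variable
  series filtered by total order.\<close>

locale filtered_algebra = unital_ring_hom \<iota> + filtered_ring J
  for \<iota> :: "'a::comm_ring_1 \<Rightarrow> 'r::comm_ring_1" and J :: "nat \<Rightarrow> 'r set"
begin

definition value_of :: "'a fps \<Rightarrow> 'r \<Rightarrow> 'r \<Rightarrow> bool" where
  "value_of g x y \<longleftrightarrow> (\<forall>n. y - (\<Sum>i<n. \<iota> (g $ i) * x ^ i) \<in> J n)"

lemma value_of_unique: "value_of g x y \<Longrightarrow> value_of g x z \<Longrightarrow> y = z"
  using J_diff unfolding value_of_def
  by (intro J_eqI) (metis (no_types, lifting) diff_diff_eq2 diff_add_cancel)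

lemma value_of_const: "value_of (fps_const c) x (\<iota> c)"
  unfolding value_of_def
proof
  fix n
  show "\<iota> c - (\<Sum>i<n. \<iota> (fps_const c $ i) * x ^ i) \<in> J n"
  proof (cases n)
    case (Suc m)
    have "(\<Sum>i<n. \<iota> (fps_const c $ i) * x ^ i) = (\<Sum>i<n. if i = 0 then \<iota> c else 0)"
      by (rule sum.cong) auto
    then show ?thesis using Suc by (simp add: J_zero)
  qed (simp add: J_0)
qed

lemma value_of_X:
  assumes "x \<in> J 1"
  shows "value_of fps_X x x"
  unfolding value_of_def
proof
  fix n
  have "(\<Sum>i<n. \<iota> (fps_X $ i) * x ^ i) = (\<Sum>i<n. if i = 1 then x else 0)"
    by (rule sum.cong) (auto simp: fps_X_def)
  then show "x - (\<Sum>i<n. \<iota> (fps_X $ i) * x ^ i) \<in> J n"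
    using assms J_0 J_zero by (cases "n = 0"; cases "n = 1") auto
qed

lemma value_of_add:
  assumes "value_of g x y" "value_of h x z"
  shows "value_of (g + h) x (y + z)"
  unfolding value_of_def
proof
  fix n
  show "y + z - (\<Sum>i<n. \<iota> ((g + h) $ i) * x ^ i) \<in> J n"
    using J_add[of "y - (\<Sum>i<n. \<iota> (g $ i) * x ^ i)" n "z - (\<Sum>i<n. \<iota> (h $ i) * x ^ i)"] assms
    by (simp add: value_of_def distrib_right sum.distrib algebra_simps)
qed

lemma value_of_mult:
  assumes x: "x \<in> J 1" and y: "value_of g x y" and z: "value_of h x z"
  shows "value_of (g * h) x (y * z)"
  unfolding value_of_def
proof
  fix n
  let ?G = "\<Sum>i<n. \<iota> (g $ i) * x ^ i" and ?H = "\<Sum>i<n. \<iota> (h $ i) * x ^ i"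
  let ?t = "\<lambda>(i, j). (\<iota> (g $ i) * x ^ i) * (\<iota> (h $ j) * x ^ j)"
  let ?S = "{..<n} \<times> {..<n}" and ?T = "{(i, j). i + j < n}"
  have T: "?T \<subseteq> ?S" by auto
  have "(\<Sum>k<n. \<iota> ((g * h) $ k) * x ^ k) = (\<Sum>k<n. \<Sum>i\<le>k. ?t (i, k - i))"
  proof (rule sum.cong[OF refl])
    fix k
    have "\<iota> (g $ i * h $ (k - i)) * x ^ k = ?t (i, k - i)" if "i \<le> k" for i
    proof -
      have "x ^ k = x ^ i * x ^ (k - i)" using that by (simp flip: power_add)
      then show ?thesis by (simp add: mult_ac)
    qed
    then show "\<iota> ((g * h) $ k) * x ^ k = (\<Sum>i\<le>k. ?t (i, k - i))"
      unfolding fps_mult_nth map_sum sum_distrib_right atMost_atLeast0 by (intro sum.cong) auto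
  qed
  also have "\<dots> = (\<Sum>p\<in>?T. ?t p)"
    by (subst sum.triangle_reindex[symmetric]) (simp add: case_prod_beta)
  \<comment> \<open>The product of the truncations has exactly the surplus terms with i + j >= n,
    and these lie in \<open>J n\<close>.\<close>
  finally have "?G * ?H - (\<Sum>k<n. \<iota> ((g * h) $ k) * x ^ k) = (\<Sum>p\<in>?S - ?T. ?t p)"
    using T by (simp add: sum_product sum.cartesian_product sum_diff)
  also have "\<dots> \<in> J n"
  proof (rule J_sum)
    fix p assume "p \<in> ?S - ?T"
    then obtain i j where p: "p = (i, j)" and "n \<le> i + j" by (cases p) auto
    then have "x ^ (i + j) \<in> J n" using J_power[OF x] J_mono by blast
    then have "\<iota> (g $ i) * \<iota> (h $ j) * x ^ (i + j) \<in> J n" by (rule J_mult_left)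
    then show "?t p \<in> J n" by (simp add: p power_add mult_ac)
  qed
  finally have "?G * ?H - (\<Sum>k<n. \<iota> ((g * h) $ k) * x ^ k) \<in> J n" .
  moreover have "z * (y - ?G) \<in> J n" "?G * (z - ?H) \<in> J n"
    using y z by (auto simp: value_of_def intro!: J_mult_left)
  ultimately have "z * (y - ?G) + ?G * (z - ?H) +
      (?G * ?H - (\<Sum>k<n. \<iota> ((g * h) $ k) * x ^ k)) \<in> J n"
    by (intro J_add)
  then show "y * z - (\<Sum>k<n. \<iota> ((g * h) $ k) * x ^ k) \<in> J n"
    by (simp add: algebra_simps)
qed

lemma value_of_power: "x \<in> J 1 \<Longrightarrow> value_of g x y \<Longrightarrow> value_of (g ^ n) x (y ^ n)"
  using value_of_const[of 1 x] by (induction n) (simp_all add: value_of_mult)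

lemma value_of_sum:
  "(\<And>i. i \<in> I \<Longrightarrow> value_of (g i) x (y i)) \<Longrightarrow> value_of (\<Sum>i\<in>I. g i) x (\<Sum>i\<in>I. y i)"
  using value_of_const[of 0 x] by (induction I rule: infinite_finite_induct) (simp_all add: value_of_add)

lemma compose_nth_truncated:
  fixes g h :: "'a fps"
  assumes "g $ 0 = 0" "m < n"
  shows "(h oo g) $ m = (\<Sum>i<n. fps_const (h $ i) * g ^ i) $ m"
proof -
  have "(h oo g) $ m = (\<Sum>i\<in>{0..m}. h $ i * (g ^ i) $ m)" by (rule fps_compose_nth)
  also have "\<dots> = (\<Sum>i<n. h $ i * (g ^ i) $ m)"
    by (rule sum.mono_neutral_left) (use assms startsby_zero_power_prefix in fastforce)+
  finally show ?thesis by (simp add: fps_sum_nth)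
qed

text \<open>Since g^i starts in degree i, the composite agrees below degree n with the polynomial
  \<open>?p\<close> in g, whose value is a finite combination of powers of y.\<close>

lemma value_of_compose:
  assumes x: "x \<in> J 1" and g: "g $ 0 = 0" "value_of g x y" and h: "value_of h y z"
  shows "value_of (h oo g) x z"
  unfolding value_of_def
proof
  fix n
  let ?p = "\<Sum>i<n. fps_const (h $ i) * g ^ i"
  have "value_of ?p x (\<Sum>i<n. \<iota> (h $ i) * y ^ i)"
    by (intro value_of_sum value_of_mult value_of_const value_of_power x g)
  then have "(\<Sum>i<n. \<iota> (h $ i) * y ^ i) - (\<Sum>i<n. \<iota> (?p $ i) * x ^ i) \<in> J n"
    unfolding value_of_def by blast
  moreover have "z - (\<Sum>i<n. \<iota> (h $ i) * y ^ i) \<in> J n"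
    using h unfolding value_of_def by blast
  ultimately have "z - (\<Sum>i<n. \<iota> (?p $ i) * x ^ i) \<in> J n"
    using J_add by fastforce
  then show "z - (\<Sum>i<n. \<iota> ((h oo g) $ i) * x ^ i) \<in> J n"
    using g(1) by (simp add: compose_nth_truncated[of g _ n h])
qed

end

section \<open>Composition of power series over commutative rings\<close>

text \<open>The library proves these facts for integral domains only, whereas the coefficients are needed in
  rings of total operations.\<close>

lemma filtered_algebra_fps:
  "filtered_algebra fps_const (\<lambda>n. {F :: 'a::comm_ring_1 fps. \<forall>m<n. F $ m = 0})"
proof
  show "u * v \<in> {F. \<forall>i<m + n. F $ i = 0}"
    if "u \<in> {F. \<forall>i<m. F $ i = 0}" "v \<in> {F. \<forall>i<n. F $ i = 0}" for u v :: "'a fps" and m n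
  proof (clarify)
    fix k assume "k < m + n"
    then have "u $ i * v $ (k - i) = 0" if "i \<in> {0..k}" for i
      using that \<open>u \<in> _\<close> \<open>v \<in> _\<close> by (cases "i < m") auto
    then show "(u * v) $ k = 0" by (simp add: fps_mult_nth)
  qed
qed (auto simp: fps_eq_iff, metis lessI)

text \<open>Composition is evaluation at \<open>c\<close> in the X-adic filtration, so identities
  for \<open>oo\<close> follow from uniqueness of values.\<close>

lemma value_of_fps_compose:
  assumes "(c :: 'a::comm_ring_1 fps) $ 0 = 0"
  shows "filtered_algebra.value_of fps_const (\<lambda>n. {F. \<forall>m<n. F $ m = 0}) a c (a oo c)"
  unfolding filtered_algebra.value_of_def[OF filtered_algebra_fps]
  using filtered_algebra.compose_nth_truncated[OF filtered_algebra_fps assms] by auto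

lemma compose_mult:
  assumes "(c :: 'a::comm_ring_1 fps) $ 0 = 0"
  shows "(a * b) oo c = (a oo c) * (b oo c)"
proof -
  interpret filtered_algebra fps_const "\<lambda>n. {F :: 'a fps. \<forall>m<n. F $ m = 0}"
    by (rule filtered_algebra_fps)
  note val = value_of_fps_compose[OF assms]
  show ?thesis
    by (rule value_of_unique[OF val value_of_mult[OF _ val val]]) (use assms in simp)
qed

lemma compose_assoc:
  assumes "(c :: 'a::comm_ring_1 fps) $ 0 = 0" "b $ 0 = 0"
  shows "(a oo b) oo c = a oo (b oo c)"
proof -
  interpret filtered_algebra fps_const "\<lambda>n. {F :: 'a fps. \<forall>m<n. F $ m = 0}"
    by (rule filtered_algebra_fps)
  have "(b oo c) $ 0 = 0" using assms by simp
  then have "value_of (a oo b) c (a oo (b oo c))"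
    using assms by (intro value_of_compose[where y = "b oo c"] value_of_fps_compose) auto
  then show ?thesis
    using value_of_unique value_of_fps_compose[OF assms(1)] by blast
qed

definition map_fps :: "('a \<Rightarrow> 'b) \<Rightarrow> 'a fps \<Rightarrow> 'b fps" where
  "map_fps \<phi> F = Abs_fps (\<lambda>n. \<phi> (F $ n))"

lemma map_fps_nth [simp]: "map_fps \<phi> F $ n = \<phi> (F $ n)"
  by (simp add: map_fps_def)

context unital_ring_hom
begin

lemma map_fps_hom: "unital_ring_hom (map_fps \<phi>)"
  by standard (auto simp: fps_eq_iff fps_mult_nth map_sum)

lemma map_fps_const [simp]: "map_fps \<phi> (fps_const c) = fps_const (\<phi> c)"
  by (simp add: fps_eq_iff)

lemma map_fps_X [simp]: "map_fps \<phi> fps_X = fps_X"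
  by (simp add: fps_eq_iff fps_X_def)

lemma map_fps_compose: "map_fps \<phi> (F oo G) = map_fps \<phi> F oo map_fps \<phi> G"
proof (rule fps_ext)
  fix n
  show "map_fps \<phi> (F oo G) $ n = (map_fps \<phi> F oo map_fps \<phi> G) $ n"
    by (simp add: fps_compose_nth map_sum flip: unital_ring_hom.map_power[OF map_fps_hom])
qed

end

text \<open>Solves the equation for degree n in b oo a = X for b_n, whose factor is 1 because a^n
  starts with X^n.\<close>

fun left_inverse_coeff :: "'a::comm_ring_1 fps \<Rightarrow> nat \<Rightarrow> 'a" where
  "left_inverse_coeff a n = fps_X $ n - (\<Sum>i\<in>{..<n}. left_inverse_coeff a i * (a ^ i) $ n)"

declare left_inverse_coeff.simps [simp del]

lemma ex_left_inverse:
  assumes "(a :: 'a::comm_ring_1 fps) $ 0 = 0" "a $ 1 = 1"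
  shows "\<exists>b. b $ 0 = 0 \<and> b $ 1 = 1 \<and> b oo a = fps_X"
proof (intro exI conjI)
  let ?b = "Abs_fps (left_inverse_coeff a)"
  show 0: "?b $ 0 = 0" by (simp add: left_inverse_coeff.simps[of _ 0])
  then show "?b $ 1 = 1" by (simp add: left_inverse_coeff.simps[of _ "Suc 0"])
  show "?b oo a = fps_X"
  proof (rule fps_ext)
    fix n
    have "(?b oo a) $ n = (\<Sum>i<n. left_inverse_coeff a i * (a ^ i) $ n) + left_inverse_coeff a n"
      using assms by (simp add: fps_compose_nth atLeast0AtMost startsby_zero_power_nth_same
          flip: lessThan_Suc_atMost)
    then show "(?b oo a) $ n = fps_X $ n" by (simp add: left_inverse_coeff.simps[of _ n])
  qed
qed

text \<open>A left inverse b of a has itself a left inverse c, and associativity forces c = a, as in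
  a group.\<close>

lemma ex_compositional_inverse:
  assumes a: "(a :: 'a::comm_ring_1 fps) $ 0 = 0" "a $ 1 = 1"
  obtains b where "b $ 0 = 0" "b $ 1 = 1" "b oo a = fps_X" "a oo b = fps_X"
proof -
  obtain b where b: "b $ 0 = 0" "b $ 1 = 1" "b oo a = fps_X"
    using ex_left_inverse[OF a] by blast
  obtain c where c: "c $ 0 = 0" "c oo b = fps_X"
    using ex_left_inverse[OF b(1,2)] by blast
  have "a = (c oo b) oo a" using a c by simp
  also have "\<dots> = c" using a b by (simp add: compose_assoc)
  finally show ?thesis using that b c by blast
qed

lemma compose_right_cancel:
  assumes "(a :: 'a::comm_ring_1 fps) $ 0 = 0" "a $ 1 = 1"
  shows "F oo a = G oo a \<longleftrightarrow> F = G"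
proof
  obtain b where b: "b $ 0 = 0" "a oo b = fps_X" using ex_compositional_inverse[OF assms] .
  assume "F oo a = G oo a"
  then have "(F oo a) oo b = (G oo a) oo b" by simp
  then show "F = G" using assms b by (simp add: compose_assoc)
qed simp

lemma comp_inverse_eq:
  assumes "(h :: 'a::comm_ring_1 fps) $ 0 = 0" "g $ 0 = 0" "g oo h = fps_X" "h oo g = fps_X"
  shows "comp_inverse g = h"
  unfolding comp_inverse_def
proof (rule the_equality)
  fix h' assume h': "h' $ 0 = 0 \<and> g oo h' = fps_X \<and> h' oo g = fps_X"
  have "h' = (h oo g) oo h'" using assms h' by simp
  also have "\<dots> = h" by (subst compose_assoc) (use assms h' in auto)
  finally show "h' = h" .
qed (use assms in auto)

text \<open>Ring operations reach every truncation of F, and the remainder after n terms is a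
  multiple of X^n.\<close>

lemma fps_adic_induct [case_names const X add mult limit]:
  fixes F :: "'a::comm_ring_1 fps"
  assumes "\<And>c. P (fps_const c)" "P fps_X" "\<And>F G. P F \<Longrightarrow> P G \<Longrightarrow> P (F + G)"
    "\<And>F G. P F \<Longrightarrow> P G \<Longrightarrow> P (F * G)"
    "\<And>F. (\<And>n. \<exists>G H. P G \<and> F = G + fps_X ^ n * H) \<Longrightarrow> P F"
  shows "P F"
proof (rule assms(5))
  fix n
  have pow: "P (fps_X ^ i)" for i
    using assms(1)[of 1] by (induction i) (simp_all add: assms(2,4))
  have "P (\<Sum>i<n. fps_const (F $ i) * fps_X ^ i)"
    using assms(1)[of 0] by (induction n) (simp_all add: assms(1,3,4) pow)
  moreover have "F = (\<Sum>i<n. fps_const (F $ i) * fps_X ^ i) + fps_X ^ n * fps_shift n F"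
    by (rule fps_ext) (simp add: fps_sum_nth fps_X_power_mult_nth fps_X_power_nth if_distrib cong: if_cong)
  ultimately show "\<exists>G H. P G \<and> F = G + fps_X ^ n * H" by blast
qed

section \<open>Adjoining a geometric cobordism element\<close>

text \<open>The series $\sum_k b_k x^{k+1}$ with $b_0 = 1$.\<close>

definition geometric_series :: "'a::ring_1 opseries fps" where
  "geometric_series = Abs_fps (\<lambda>n. Opseries (\<lambda>w. if size w \<le> 1 \<and> weight w + 1 = n then 1 else 0))"

lemma geometric_series_nth:
  "op_coeff (geometric_series $ m) w = (if size w \<le> 1 \<and> m = weight w + 1 then 1 else 0)"
  by (auto simp: geometric_series_def)

lemma geometric_series_0: "geometric_series $ 0 = 0"
  by (rule opseries_eqI) (simp add: geometric_series_nth)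

text \<open>The Cauchy product step shared by the powers of \<open>geometric_series\<close> and of
  \<open>gen_series\<close>: in both, the entry at u of the coefficient of degree j is 1 if u is a
  row with weight u + 1 = j, and 0 otherwise.\<close>

lemma power_coeff_convolution:
  "(\<Sum>j=0..m. \<Sum>(u, v)\<in>splittings w. (if size u \<le> 1 \<and> j = weight u + 1 then 1 else 0) *
      (if m - j = weight v + i then of_int (power_coeff i v) else 0)) =
    (if m = weight w + Suc i then of_int (power_coeff (Suc i) w) else (0::'a::ring_1))"
proof -
  let ?t = "\<lambda>j (u, v). (if size u \<le> 1 \<and> j = weight u + 1 then 1 else 0) *
      (if m - j = weight v + i then of_int (power_coeff i v) else (0::'a))"
  have "(\<Sum>j=0..m. ?t j p) =
      (if m = weight w + Suc i then of_int (if size (fst p) \<le> 1 then power_coeff i (snd p) else 0) else 0)"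
    if "p \<in> splittings w" for p
  proof -
    obtain u v where p: "p = (u, v)" by (cases p)
    then have w: "weight w = weight u + weight v" using that by (simp add: weight_splitting)
    have "(\<Sum>j=0..m. ?t j p) = (\<Sum>j=0..m. if j = weight u + 1 then
        (if size u \<le> 1 \<and> m = weight w + Suc i then of_int (power_coeff i v) else (0::'a)) else 0)"
      by (rule sum.cong) (auto simp: p w)
    then show ?thesis by (auto simp: p w)
  qed
  then have "(\<Sum>p\<in>splittings w. \<Sum>j=0..m. ?t j p) =
      (if m = weight w + Suc i then of_int (power_coeff (Suc i) w) else 0)"
    by (simp add: power_coeff_Suc case_prod_beta)
  then show ?thesis by (subst sum.swap)
qed

lemma geometric_series_power:
  "op_coeff ((geometric_series :: 'a::ring_1 opseries fps) ^ i $ m) w =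
     (if m = weight w + i then of_int (power_coeff i w) else 0)"
proof (induction i arbitrary: m w)
  case 0
  then show ?case by (auto simp: op_coeff_1 power_coeff_0)
next
  case (Suc i)
  then show ?case
    by (simp only: power_Suc fps_mult_nth op_coeff_sum op_coeff_mult geometric_series_nth
        power_coeff_convolution)
qed

text \<open>Values lie in \<open>'b opseries fps\<close> rather than \<open>'b fps opseries\<close>,
  so that composition of power series is available; \<open>ext_action\<close> reads off the
  coefficient of b^w in each degree of x.\<close>

definition ext_total :: "(LN \<Rightarrow> 'b::comm_ring_1 \<Rightarrow> 'b) \<Rightarrow> 'b fps \<Rightarrow> 'b opseries fps" where
  "ext_total A F = map_fps (total_op A) F oo geometric_series"

definition ext_action :: "(LN \<Rightarrow> 'b::comm_ring_1 \<Rightarrow> 'b) \<Rightarrow> LN \<Rightarrow> 'b fps \<Rightarrow> 'b fps" where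
  "ext_action A s F = lin_ext (\<lambda>w. Abs_fps (\<lambda>m. op_coeff (ext_total A F $ m) w)) s"

lemma ext_action_nth: "ext_action A (s_elem w) F $ m = op_coeff (ext_total A F $ m) w"
  by (simp add: ext_action_def)

text \<open>The Cartan formula for s_w(F_i x^i), with no composition of series left. In this form it
  can be carried along \<iota> into noncommutative rings.\<close>

lemma ext_action_nth_explicit:
  "ext_action A (s_elem w) F $ m = (\<Sum>i\<le>m. \<Sum>(u, v)\<in>splittings w.
     if m = weight v + i then A (s_elem u) (F $ i) * of_int (power_coeff i v) else 0)"
  by (simp add: ext_action_nth ext_total_def fps_compose_nth op_coeff_mult geometric_series_power
      atMost_atLeast0 if_distrib cong: if_cong)

lemma fps_X_power_dvd_imp_0:
  fixes d :: "'a::comm_ring_1 fps"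
  assumes "\<And>n. fps_X ^ n dvd d"
  shows "d = 0"
proof (rule fps_ext)
  fix n
  obtain r where "d = fps_X ^ Suc n * r" using assms by (meson dvdE)
  then show "d $ n = 0 $ n" by (simp only: fps_X_power_mult_nth) simp
qed

text \<open>Separatedness in the inner variable x_1, checked on each coefficient in the outer
  one.\<close>

lemma fps_const_X_power_dvd_imp_0:
  fixes d :: "'a::comm_ring_1 fps fps"
  assumes "\<And>n. fps_const fps_X ^ n dvd d"
  shows "d = 0"
proof (rule fps_ext)
  fix m
  have "fps_X ^ n dvd d $ m" for n
  proof -
    obtain r where "d = fps_const fps_X ^ n * r" using assms by (meson dvdE)
    then have "d $ m = fps_X ^ n * r $ m" by (simp add: fps_const_power)
    then show ?thesis by simp
  qed
  then have "d $ m = 0" by (rule fps_X_power_dvd_imp_0)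
  then show "d $ m = 0 $ m" by simp
qed

context
  fixes A :: "LN \<Rightarrow> 'b::comm_ring_1 \<Rightarrow> 'b"
  assumes A: "cartan_action A"
begin

interpretation A: unital_ring_hom "total_op A" by (rule total_hom[OF A])

lemma ext_total_mult: "ext_total A (F * G) = ext_total A F * ext_total A G"
  by (simp add: ext_total_def compose_mult geometric_series_0 unital_ring_hom.map_mult[OF A.map_fps_hom])

lemma ext_total_add: "ext_total A (F + G) = ext_total A F + ext_total A G"
  by (simp add: ext_total_def fps_compose_add_distrib unital_ring_hom.map_add[OF A.map_fps_hom])

lemma ext_total_const: "ext_total A (fps_const c) = fps_const (total_op A c)"
  by (simp add: ext_total_def)

lemma ext_total_X: "ext_total A fps_X = geometric_series"
  by (simp add: ext_total_def geometric_series_0)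

lemma cartan_ext_action: "cartan_action (ext_action A)"
proof (rule cartan_actionI)
  show "ext_action A s u = lin_ext (\<lambda>w. ext_action A (s_elem w) u) s" for s u
    by (rule additive_eq_lin_ext) (simp add: ext_action_def)
  show "ext_action A (s_elem w) (u + v) = ext_action A (s_elem w) u + ext_action A (s_elem w) v" for w u v
    by (rule fps_ext) (simp add: ext_action_nth ext_total_add)
  show "ext_action A (s_elem {#}) u = u" for u
  proof (rule fps_ext)
    fix m
    show "ext_action A (s_elem {#}) u $ m = u $ m"
      by (simp add: ext_action_nth_explicit[of A "{#}", simplified] sum_splittings_empty cartan_unit[OF A])
  qed
  show "ext_action A (s_elem w) (u * v) =
      (\<Sum>(w', w'')\<in>splittings w. ext_action A (s_elem w') u * ext_action A (s_elem w'') v)" for w u v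
  proof (rule fps_ext)
    fix m
    have "ext_action A (s_elem w) (u * v) $ m = (\<Sum>i=0..m. \<Sum>(w', w'')\<in>splittings w.
        ext_action A (s_elem w') u $ i * ext_action A (s_elem w'') v $ (m - i))"
      by (simp add: ext_action_nth ext_total_mult fps_mult_nth op_coeff_mult)
    also have "\<dots> = (\<Sum>(w', w'')\<in>splittings w. \<Sum>i=0..m.
        ext_action A (s_elem w') u $ i * ext_action A (s_elem w'') v $ (m - i))"
      by (simp add: case_prod_beta sum.swap[where A = "{0..m}"])
    also have "\<dots> = (\<Sum>(w', w'')\<in>splittings w. ext_action A (s_elem w') u * ext_action A (s_elem w'') v) $ m"
      by (simp add: fps_sum_nth fps_mult_nth case_prod_beta)
    finally show "ext_action A (s_elem w) (u * v) $ m =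
        (\<Sum>(w', w'')\<in>splittings w. ext_action A (s_elem w') u * ext_action A (s_elem w'') v) $ m" .
  qed
qed

lemma ext_action_const: "ext_action A s (fps_const c) = fps_const (A s c)"
proof (rule additive_eqI[of "\<lambda>s. ext_action A s (fps_const c)" "\<lambda>s. fps_const (A s c)"])
  show "ext_action A (s_elem w) (fps_const c) = fps_const (A (s_elem w) c)" for w
    by (rule fps_ext) (simp add: ext_action_nth ext_total_const)
qed (simp_all add: cartan_add_left[OF A] cartan_add_left[OF cartan_ext_action])

lemma geometric_ext_action_X: "geometric_operations (ext_action A) fps_X"
  unfolding geometric_operations_weight[OF cartan_ext_action]
  by (auto simp: fps_eq_iff ext_action_nth ext_total_X geometric_series_nth fps_X_power_nth simp del: power_Suc)

lemma geometric_ext_action_const: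
  "geometric_operations A c \<Longrightarrow> geometric_operations (ext_action A) (fps_const c)"
  by (simp add: geometric_operations_def ext_action_const fps_const_power fps_const_mult[symmetric] del: fps_const_mult)

end

text \<open>The elements on which composites are correct include constants and X and are closed
  under ring operations and X-adic limits. Applied twice, this turns S^* into
  S^*[[x_1]][[x_2]].\<close>

lemma milnor_ext_action:
  assumes "milnor_module A"
  shows "milnor_module (ext_action A)"
proof -
  have A: "cartan_action A" and comp: "\<And>u. composes A u"
    using assms by (auto simp: milnor_module_iff_composes)
  note E = cartan_ext_action[OF A]
  have "composes (ext_action A) F" for F
  proof (induction F rule: fps_adic_induct)
    case (const c)
    show ?case using comp[of c] by (simp add: composes_def ext_action_const[OF A])
  next
    case X
    show ?case by (rule composes_geometric[OF E geometric_ext_action_X[OF A]])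
  next
    case (add F G)
    then show ?case by (rule composes_add[OF E])
  next
    case (mult F G)
    then show ?case by (rule composes_mult[OF E])
  next
    case (limit F)
    show ?case
      by (rule composes_limit[OF E geometric_ext_action_X[OF A] fps_X_power_dvd_imp_0 limit])
  qed
  then show ?thesis using E by (simp add: milnor_module_iff_composes)
qed

text \<open>The map \<open>h\<close> is the identity for an outermost variable and
  \<open>fps_const\<close> for x_1 inside the ring of two variables. Agreement passes to limits
  because both actions preserve divisibility by powers of the variable.\<close>

lemma cartan_eq_on_fps:
  fixes A A' :: "LN \<Rightarrow> 'r::comm_ring_1 \<Rightarrow> 'r" and h :: "'b::comm_ring_1 fps \<Rightarrow> 'r"
  assumes A: "cartan_action A" "geometric_operations A (h fps_X)"
    and A': "cartan_action A'" "geometric_operations A' (h fps_X)"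
    and h: "unital_ring_hom h"
    and sep: "\<And>d. (\<And>n. h fps_X ^ n dvd d) \<Longrightarrow> d = 0"
    and const: "\<And>c. total_op A (h (fps_const c)) = total_op A' (h (fps_const c))"
  shows "total_op A (h F) = total_op A' (h F)"
proof -
  interpret h: unital_ring_hom h by (rule h)
  interpret A: unital_ring_hom "total_op A" by (rule total_hom[OF A(1)])
  interpret A': unital_ring_hom "total_op A'" by (rule total_hom[OF A'(1)])
  show ?thesis
  proof (induction F rule: fps_adic_induct)
    case X
    then show ?case using A A' by (simp add: geometric_operations_total)
  next
    case (limit F)
    show ?case
    proof (rule opseries_eqI)
      fix w
      have "A (s_elem w) (h F) - A' (s_elem w) (h F) = 0"
      proof (rule sep)
        fix n
        obtain G H where G: "total_op A (h G) = total_op A' (h G)" and F: "F = G + fps_X ^ n * H"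
          using limit by blast
        have "A (s_elem w) (h G) = A' (s_elem w) (h G)"
          using G by (metis op_coeff_total_op)
        then have "A (s_elem w) (h F) - A' (s_elem w) (h F) =
            A (s_elem w) (h fps_X ^ n * h H) - A' (s_elem w) (h fps_X ^ n * h H)"
          by (simp add: F cartan_add[OF A(1)] cartan_add[OF A'(1)])
        then show "h fps_X ^ n dvd A (s_elem w) (h F) - A' (s_elem w) (h F)"
          by (simp add: geometric_power_dvd[OF A] geometric_power_dvd[OF A'])
      qed
      then show "op_coeff (total_op A (h F)) w = op_coeff (total_op A' (h F)) w" by simp
    qed
  qed (simp_all add: const)
qed

section \<open>Invariant series\<close>

text \<open>Invariance under all s_w of positive degree becomes equality of the total operation with
  this inclusion, a condition compatible with ring operations and composition.\<close>

definition const_op :: "'a::zero \<Rightarrow> 'a opseries" where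
  "const_op u = Opseries (\<lambda>w. if w = {#} then u else 0)"

lemma op_coeff_const_op [simp]: "op_coeff (const_op u) w = (if w = {#} then u else 0)"
  by (simp add: const_op_def)

lemma const_op_hom: "unital_ring_hom (const_op :: 'a::ring_1 \<Rightarrow> 'a opseries)"
proof
  fix x y :: 'a
  show "const_op (x * y) = const_op x * const_op y"
  proof (rule opseries_eqI)
    fix w
    have "op_coeff (const_op x * const_op y) w =
        (\<Sum>(u, v)\<in>splittings w. if v = {#} then (if u = {#} then x * y else 0) else 0)"
      unfolding op_coeff_mult by (rule sum.cong) auto
    then show "op_coeff (const_op (x * y)) w = op_coeff (const_op x * const_op y) w"
      by (simp add: sum_splittings_delta)
  qed
qed (auto intro: opseries_eqI simp: op_coeff_1)

lemma total_eq_const_op_iff: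
  assumes "cartan_action A"
  shows "total_op A u = const_op u \<longleftrightarrow> (\<forall>w. w \<noteq> {#} \<longrightarrow> A (s_elem w) u = 0)"
proof -
  have "total_op A u = const_op u \<longleftrightarrow> (\<forall>w. A (s_elem w) u = (if w = {#} then u else 0))"
    by (simp add: total_op_def const_op_def Opseries_inject fun_eq_iff)
  then show ?thesis using cartan_unit[OF assms] by auto
qed

lemma ext_total_eq_const_op_iff:
  assumes "cartan_action A"
  shows "ext_total A F = map_fps const_op F \<longleftrightarrow> (\<forall>w. w \<noteq> {#} \<longrightarrow> ext_action A (s_elem w) F = 0)"
proof -
  have "ext_total A F = map_fps const_op F \<longleftrightarrow>
      (\<forall>w. ext_action A (s_elem w) F = (if w = {#} then F else 0))"
    by (auto simp: fps_eq_iff ext_action_nth op_coeff_inject[symmetric] fun_eq_iff)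
  then show ?thesis using cartan_unit[OF cartan_ext_action[OF assms]] by auto
qed

text \<open>Composing with the constant series \<open>\<sigma>\<close> turns \<open>ext_total A G\<close> into
  \<open>map_fps (total_op A) (G oo \<sigma>)\<close>, and \<open>\<sigma>\<close> can be cancelled.\<close>

lemma invariant_iff_compose:
  fixes A :: "LN \<Rightarrow> 'b::comm_ring_1 \<Rightarrow> 'b"
  assumes A: "cartan_action A"
    and \<sigma>: "\<sigma> $ 0 = 0" "\<sigma> $ 1 = 1"
    and total_\<sigma>: "map_fps (total_op A) \<sigma> = geometric_series oo map_fps const_op \<sigma>"
  shows "(\<forall>w. w \<noteq> {#} \<longrightarrow> ext_action A (s_elem w) G = 0) \<longleftrightarrow>
    (\<forall>n w. w \<noteq> {#} \<longrightarrow> A (s_elem w) ((G oo \<sigma>) $ n) = 0)"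
proof -
  interpret A: unital_ring_hom "total_op A" by (rule total_hom[OF A])
  interpret K: unital_ring_hom "const_op :: 'b \<Rightarrow> 'b opseries" by (rule const_op_hom)
  let ?K = "map_fps const_op"
  have K\<sigma>: "?K \<sigma> $ 0 = 0" "?K \<sigma> $ 1 = 1" using \<sigma> by simp_all
  have "ext_total A G = ?K G \<longleftrightarrow> ext_total A G oo ?K \<sigma> = ?K G oo ?K \<sigma>"
    by (rule compose_right_cancel[OF K\<sigma>, symmetric])
  also have "ext_total A G oo ?K \<sigma> = map_fps (total_op A) (G oo \<sigma>)"
    by (simp only: ext_total_def compose_assoc[OF K\<sigma>(1) geometric_series_0] A.map_fps_compose total_\<sigma>)
  also have "?K G oo ?K \<sigma> = ?K (G oo \<sigma>)"
    by (simp add: K.map_fps_compose)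
  also have "map_fps (total_op A) (G oo \<sigma>) = ?K (G oo \<sigma>) \<longleftrightarrow>
      (\<forall>n. total_op A ((G oo \<sigma>) $ n) = const_op ((G oo \<sigma>) $ n))"
    by (simp add: fps_eq_iff)
  finally show ?thesis
    by (simp add: ext_total_eq_const_op_iff[OF A] total_eq_const_op_iff[OF A])
qed

section \<open>Grading\<close>

lemma dual_component_weight: "l \<in> dual_component d \<longleftrightarrow> (\<forall>w. Poly_Mapping.lookup l w \<noteq> 0 \<longrightarrow> d = - 2 * int (weight w))"
  by (auto simp: dual_component_def coll_degree_weight in_keys_iff)

lemma dual_component_zero [simp]: "0 \<in> dual_component d"
  by (simp add: dual_component_weight)

lemma dual_component_add: "l \<in> dual_component d \<Longrightarrow> m \<in> dual_component d \<Longrightarrow> l + m \<in> dual_component d"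
  unfolding dual_component_weight lookup_add by (metis add.right_neutral)

lemma dual_component_diff: "l \<in> dual_component d \<Longrightarrow> m \<in> dual_component d \<Longrightarrow> l - m \<in> dual_component d"
  unfolding dual_component_weight lookup_minus by (metis diff_zero)

lemma dual_component_sum: "(\<And>i. i \<in> I \<Longrightarrow> f i \<in> dual_component d) \<Longrightarrow> (\<Sum>i\<in>I. f i) \<in> dual_component d"
  by (induction I rule: infinite_finite_induct) (auto simp: dual_component_add)

lemma dual_component_mult:
  assumes "l \<in> dual_component d" "m \<in> dual_component e"
  shows "l * m \<in> dual_component (d + e)"
  unfolding dual_component_weight
proof (intro allI impI)
  fix w assume "Poly_Mapping.lookup (l * m) w \<noteq> 0"
  then obtain u v where "(u, v) \<in> splittings w" "Poly_Mapping.lookup l u \<noteq> 0" "Poly_Mapping.lookup m v \<noteq> 0"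
    unfolding lookup_times_dual by (auto elim!: sum.not_neutral_contains_not_neutral)
  then show "d + e = - 2 * int (weight w)"
    using assms by (auto simp: dual_component_weight splittings_def)
qed

lemma dual_component_row: "frag_of (row n) \<in> dual_component (- 2 * int n)"
  by (simp add: dual_component_weight)

lemma dual_component_one: "1 \<in> dual_component 0"
  using dual_component_row[of 0] by (simp add: row_def)

lemma series_componentD: "F \<in> series_component d \<Longrightarrow> F $ i \<in> dual_component (d - 2 * int i)"
  by (simp add: series_component_def)

lemma series_component_zero: "0 \<in> series_component d"
  by (simp add: series_component_def)

lemma series_component_sum:
  "(\<And>i. i \<in> I \<Longrightarrow> f i \<in> series_component d) \<Longrightarrow> (\<Sum>i\<in>I. f i) \<in> series_component d"
  by (simp add: series_component_def fps_sum_nth dual_component_sum)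

lemma series_component_mult:
  assumes "F \<in> series_component d" "G \<in> series_component e"
  shows "F * G \<in> series_component (d + e)"
proof -
  have "F $ i * G $ (n - i) \<in> dual_component (d + e - 2 * int n)" if "i \<le> n" for i n
    using dual_component_mult[OF series_componentD[OF assms(1), of i] series_componentD[OF assms(2), of "n - i"]] that
    by (simp add: of_nat_diff algebra_simps)
  then show ?thesis
    by (auto simp: series_component_def fps_mult_nth intro!: dual_component_sum)
qed

lemma series_component_one: "1 \<in> series_component 0"
  by (simp add: series_component_def dual_component_one)

lemma series_component_power: "F \<in> series_component d \<Longrightarrow> F ^ n \<in> series_component (int n * d)"
proof (induction n)
  case (Suc n)
  then show ?case using series_component_mult[of F d "F ^ n" "int n * d"] by (simp add: algebra_simps)
qed (simp add: series_component_one)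

lemma series_component_X: "fps_X \<in> series_component 2"
  by (auto simp: series_component_def fps_X_def dual_component_one)

lemma series_component_compose:
  assumes "F \<in> series_component d" "G \<in> series_component 2"
  shows "F oo G \<in> series_component d"
proof -
  have "F $ i * (G ^ i) $ n \<in> dual_component (d - 2 * int n)" for i n
    using dual_component_mult[OF series_componentD[OF assms(1), of i]
        series_componentD[OF series_component_power[OF assms(2), of i], of n]]
    by (simp add: algebra_simps)
  then show ?thesis
    by (auto simp: series_component_def fps_compose_nth intro!: dual_component_sum)
qed

lemma series2_component_iff: "F \<in> series2_component d \<longleftrightarrow> (\<forall>j. F $ j \<in> series_component (d - 2 * int j))"
  unfolding series2_component_def series_component_def mem_Collect_eq
  by (subst all_comm) (simp add: algebra_simps)

lemma series2_component_mult:
  assumes "F \<in> series2_component d" "G \<in> series2_component e"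
  shows "F * G \<in> series2_component (d + e)"
proof -
  have "F $ i * G $ (n - i) \<in> series_component (d + e - 2 * int n)" if "i \<le> n" for i n
  proof -
    have "F $ i \<in> series_component (d - 2 * int i)" "G $ (n - i) \<in> series_component (e - 2 * int (n - i))"
      using assms by (auto simp: series2_component_iff)
    from series_component_mult[OF this] show ?thesis
      using that by (simp add: of_nat_diff algebra_simps)
  qed
  then show ?thesis
    by (auto simp: series2_component_iff fps_mult_nth intro!: series_component_sum)
qed

lemma series2_component_one: "1 \<in> series2_component 0"
  by (simp add: series2_component_iff series_component_one series_component_zero)

lemma series2_component_power: "F \<in> series2_component d \<Longrightarrow> F ^ n \<in> series2_component (int n * d)"
proof (induction n)
  case (Suc n)
  then show ?case using series2_component_mult[of F d "F ^ n" "int n * d"] by (simp add: algebra_simps)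
qed (simp add: series2_component_one)

lemma series2_component_add: "F \<in> series2_component d \<Longrightarrow> G \<in> series2_component d \<Longrightarrow> F + G \<in> series2_component d"
  and series2_component_diff: "F \<in> series2_component d \<Longrightarrow> G \<in> series2_component d \<Longrightarrow> F - G \<in> series2_component d"
  by (simp_all add: series2_component_def dual_component_add dual_component_diff)

lemma series2_component_subst2:
  assumes "h \<in> series_component 2" "F \<in> series2_component 2"
  shows "subst2 h F \<in> series2_component 2"
proof -
  have "h $ n * (F ^ n) $ j $ i \<in> dual_component (2 - 2 * int i - 2 * int j)" for n i j
  proof -
    have "(F ^ n) $ j $ i \<in> dual_component (int n * 2 - 2 * int i - 2 * int j)"
      using series2_component_power[OF assms(2), of n] by (simp add: series2_component_def)
    from dual_component_mult[OF series_componentD[OF assms(1), of n] this]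
    show ?thesis by (simp add: algebra_simps)
  qed
  then show ?thesis
    by (auto simp: series2_component_def subst2_def intro!: dual_component_sum)
qed

lemma series2_component_var: "var1 \<in> series2_component 2" "var2 \<in> series2_component 2"
  by (auto simp: series2_component_def var1_def var2_def fps_X_def dual_component_one)

section \<open>The actions on power series\<close>

lemmas cartan_R_star = milnor_module_R_star[unfolded milnor_module_def, THEN conjunct1]
lemmas cartan_ext_R_star = cartan_ext_action[OF cartan_R_star]
lemmas cartan_ext2_R_star = cartan_ext_action[OF cartan_ext_R_star]

lemma unital_ring_hom_ident: "unital_ring_hom (\<lambda>x :: 'a::ring_1. x)"
  by standard auto

lemma fps_const_hom: "unital_ring_hom (fps_const :: 'a::ring_1 \<Rightarrow> 'a fps)"
  by standard auto

lemma series_act_eq: "series_act = ext_action R_star"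
  unfolding series_act_def
proof (rule the_equality)
  show "milnor_module (ext_action R_star) \<and>
      (\<forall>s l. ext_action R_star s (fps_const l) = fps_const (R_star s l)) \<and>
      geometric_cobordism (ext_action R_star) series_component fps_X"
    by (simp add: milnor_ext_action milnor_module_R_star ext_action_const cartan_R_star
        geometric_cobordism_def series_component_X geometric_ext_action_X)
next
  fix A assume A: "milnor_module A \<and> (\<forall>s l. A s (fps_const l) = fps_const (R_star s l)) \<and>
      geometric_cobordism A series_component fps_X"
  then have cA: "cartan_action A" and geo: "geometric_operations A fps_X"
    by (auto simp: milnor_module_def geometric_cobordism_def)
  have const: "total_op A (fps_const c) = total_op (ext_action R_star) (fps_const c)" for c
    using A by (simp add: total_op_def ext_action_const cartan_R_star)
  show "A = ext_action R_star"
    by (rule cartan_eqI[OF cA cartan_ext_R_star])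
      (rule cartan_eq_on_fps[where h = "\<lambda>x. x", OF cA geo cartan_ext_R_star
          geometric_ext_action_X[OF cartan_R_star] unital_ring_hom_ident fps_X_power_dvd_imp_0 const])
qed

lemma series2_act_eq: "series2_act = ext_action (ext_action R_star)"
  unfolding series2_act_def
proof (rule the_equality)
  let ?E = "ext_action (ext_action R_star)"
  have E: "geometric_operations ?E var1" "geometric_operations ?E var2"
    by (simp_all add: var1_def var2_def geometric_ext_action_X geometric_ext_action_const
        cartan_R_star cartan_ext_R_star)
  show "milnor_module ?E \<and>
      (\<forall>s l. ?E s (fps_const (fps_const l)) = fps_const (fps_const (R_star s l))) \<and>
      geometric_cobordism ?E series2_component var1 \<and> geometric_cobordism ?E series2_component var2"
    using E by (simp add: milnor_ext_action milnor_module_R_star ext_action_const cartan_R_star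
        cartan_ext_R_star geometric_cobordism_def series2_component_var)
  fix A assume A: "milnor_module A \<and>
      (\<forall>s l. A s (fps_const (fps_const l)) = fps_const (fps_const (R_star s l))) \<and>
      geometric_cobordism A series2_component var1 \<and> geometric_cobordism A series2_component var2"
  then have cA: "cartan_action A" and geo: "geometric_operations A var1" "geometric_operations A var2"
    by (auto simp: milnor_module_def geometric_cobordism_def)
  have const: "total_op A (fps_const (fps_const c)) = total_op ?E (fps_const (fps_const c))" for c
    using A by (simp add: total_op_def ext_action_const cartan_R_star cartan_ext_R_star)
  \<comment> \<open>Uniqueness proceeds one variable at a time: series in x_1 alone come here, and
    then serve as constants for x_2.\<close>
  have const': "total_op A (fps_const F) = total_op ?E (fps_const F)" for F
    by (rule cartan_eq_on_fps[where h = fps_const, OF cA geo(1)[unfolded var1_def] cartan_ext2_R_star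
          E(1)[unfolded var1_def] fps_const_hom fps_const_X_power_dvd_imp_0 const])
  show "A = ?E"
    by (rule cartan_eqI[OF cA cartan_ext2_R_star])
      (rule cartan_eq_on_fps[where h = "\<lambda>x. x", OF cA geo(2)[unfolded var2_def] cartan_ext2_R_star
          E(2)[unfolded var2_def] unital_ring_hom_ident fps_X_power_dvd_imp_0 const'])
qed

section \<open>The generating series of the generators\<close>

text \<open>This is \<sigma>(t); the coefficient of t itself is 1, in the role of s_0^*.\<close>

definition gen_series :: "LNdual fps" where
  "gen_series = fps_X + dual_series"

lemma gen_series_nth: "gen_series $ n = (if n = 0 then 0 else frag_of (row (n - 1)))"
  by (auto simp: gen_series_def dual_series_def fps_X_def s_dual_def row_def)

lemma gen_series_0: "gen_series $ 0 = 0" and gen_series_1: "gen_series $ 1 = 1"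
  by (simp_all add: gen_series_nth row_def)

lemma lookup_gen_series:
  "Poly_Mapping.lookup (gen_series $ n) w = (if size w \<le> 1 \<and> n = weight w + 1 then 1 else 0)"
proof -
  have "w = row (n - 1) \<longleftrightarrow> size w \<le> 1 \<and> n - 1 = weight w"
    using size_le_1_iff_row[of w] size_row[of "n - 1"] by (metis weight_row)
  then show ?thesis by (auto simp: gen_series_nth)
qed

lemma series_component_gen_series: "gen_series \<in> series_component 2"
  by (auto simp: series_component_def gen_series_nth dual_component_weight)

lemma lookup_gen_series_power:
  "Poly_Mapping.lookup (gen_series ^ i $ m) w = (if m = weight w + i then power_coeff i w else 0)"
proof (induction i arbitrary: m w)
  case 0
  then show ?case by (auto simp: lookup_one power_coeff_0 zero_multiset_def)
next
  case (Suc i)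
  then show ?case
    using power_coeff_convolution[where 'a = int, unfolded of_int_eq_id id_apply]
    by (simp only: power_Suc fps_mult_nth lookup_sum lookup_times_dual lookup_gen_series)
qed

text \<open>For n > 0 the coordinate at \<open>w\<close> is the coefficient of the generator indexed
  by \<open>row (n - 1)\<close> in s_w s_v, given by \<open>comp_coeff_row\<close>; powers of
  \<sigma> have the same coordinates. This is the passage from \<sigma> to \<beta> o \<sigma>, one
  coefficient at a time.\<close>

lemma R_star_gen_series:
  "R_star (s_elem v) (gen_series $ n) = (if size v \<le> 1 then gen_series ^ (weight v + 1) $ n else 0)"
proof (rule poly_mapping_eqI)
  fix w
  have "comp_sum (Poly_Mapping.lookup 0) w v = (0::int)" by (simp add: comp_sum_def)
  then have "Poly_Mapping.lookup (R_star (s_elem v) (gen_series $ n)) w =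
      (if n = 0 then 0 else comp_coeff (row (n - 1)) w v)"
    unfolding lookup_R_star gen_series_nth by (simp add: comp_sum_lookup_frag_of del: lookup_frag_of)
  then show "Poly_Mapping.lookup (R_star (s_elem v) (gen_series $ n)) w =
      Poly_Mapping.lookup (if size v \<le> 1 then gen_series ^ (weight v + 1) $ n else 0) w"
    by (auto simp: comp_coeff_row lookup_gen_series_power simp del: power_Suc)
qed

text \<open>The map \<iota> makes the identity available both over S^* itself and for the constants
  of S^*[[x_1]].\<close>

lemma total_gen_series:
  fixes A :: "LN \<Rightarrow> 'b::comm_ring_1 \<Rightarrow> 'b"
  assumes \<iota>: "unital_ring_hom \<iota>" and A: "\<And>s l. A s (\<iota> l) = \<iota> (R_star s l)"
  shows "map_fps (total_op A) (map_fps \<iota> gen_series) =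
    geometric_series oo map_fps const_op (map_fps \<iota> gen_series)"
proof (intro fps_ext opseries_eqI)
  fix n v
  interpret \<iota>: unital_ring_hom \<iota> by (rule \<iota>)
  interpret I: unital_ring_hom "map_fps \<iota>" by (rule \<iota>.map_fps_hom)
  interpret K: unital_ring_hom "map_fps (const_op :: 'b \<Rightarrow> _)"
    by (rule unital_ring_hom.map_fps_hom[OF const_op_hom])
  have mult_const: "op_coeff (f * const_op c) v = op_coeff f v * c" for f and c :: 'b
  proof -
    have "op_coeff (f * const_op c) v =
        (\<Sum>(a, b)\<in>splittings v. if b = {#} then op_coeff f a * c else 0)"
      unfolding op_coeff_mult by (rule sum.cong) auto
    then show ?thesis by (simp add: sum_splittings_delta)
  qed
  have "op_coeff ((geometric_series oo map_fps const_op (map_fps \<iota> gen_series)) $ n) v =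
      (\<Sum>i=0..n. op_coeff (geometric_series $ i) v * \<iota> (gen_series ^ i $ n))"
    by (simp add: fps_compose_nth mult_const flip: K.map_power I.map_power)
  also have "\<dots> =
      (\<Sum>i=0..n. if i = weight v + 1 then (if size v \<le> 1 then \<iota> (gen_series ^ i $ n) else 0) else 0)"
    by (rule sum.cong) (auto simp: geometric_series_nth)
  \<comment> \<open>If \<open>weight v + 1 > n\<close>, no summand survives, and the power of
    \<sigma> has no term of degree n either.\<close>
  also have "\<dots> = (if size v \<le> 1 then \<iota> (gen_series ^ (weight v + 1) $ n) else 0)"
    using startsby_zero_power_prefix[OF gen_series_0, of "weight v + 1"]
    by (auto simp: not_le less_Suc_eq_le simp del: power_Suc)
  finally show "op_coeff (map_fps (total_op A) (map_fps \<iota> gen_series) $ n) v =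
      op_coeff ((geometric_series oo map_fps const_op (map_fps \<iota> gen_series)) $ n) v"
    by (simp add: A R_star_gen_series del: power_Suc)
qed

lemma map_fps_ident: "map_fps (\<lambda>x. x) F = F"
  by (simp add: fps_eq_iff)

lemma invariant_series_iff_coeffs:
  "(\<forall>w. w \<noteq> {#} \<longrightarrow> ext_action R_star (s_elem w) G = 0) \<longleftrightarrow>
   (\<forall>n w. w \<noteq> {#} \<longrightarrow> R_star (s_elem w) ((G oo gen_series) $ n) = 0)"
  by (rule invariant_iff_compose[OF cartan_R_star gen_series_0 gen_series_1])
    (use total_gen_series[of "\<lambda>x. x" R_star] in \<open>simp add: unital_ring_hom_ident map_fps_ident\<close>)

text \<open>Only x_2 is substituted; the coefficients are series in x_1, to which the one-variable
  criterion applies in turn.\<close>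

lemma invariant_series2_iff_coeffs:
  "(\<forall>w. w \<noteq> {#} \<longrightarrow> ext_action (ext_action R_star) (s_elem w) G = 0) \<longleftrightarrow>
   (\<forall>n w. w \<noteq> {#} \<longrightarrow> ext_action R_star (s_elem w) ((G oo map_fps fps_const gen_series) $ n) = 0)"
  by (rule invariant_iff_compose[OF cartan_ext_R_star])
    (use gen_series_0 gen_series_1 total_gen_series[of fps_const "ext_action R_star"] in
      \<open>simp_all add: fps_const_hom ext_action_const cartan_R_star\<close>)

text \<open>The value of l on s_w is the pairing of \<open>R_star (s_elem w) l\<close> with 1, so
  invariance kills every coordinate except that at the empty collection, which lives in degree
  0.\<close>

lemma invariant_dual_element:
  assumes inv: "\<And>w. w \<noteq> {#} \<Longrightarrow> R_star (s_elem w) l = 0"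
    and l: "l \<in> dual_component d" and d: "d \<noteq> 0"
  shows "l = 0"
proof (rule poly_mapping_eqI)
  fix w
  show "Poly_Mapping.lookup l w = Poly_Mapping.lookup 0 w"
  proof (cases "w = {#}")
    case True
    then show ?thesis using l d by (auto simp: dual_component_weight)
  next
    case False
    have "comp_prod 1 (s_elem w) = s_elem w"
      by (rule ypoly_act_faithful) (simp add: ypoly_act_comp_prod cartan_unit[OF cartan_ypoly_act])
    then have "pairing l (s_elem w) = pairing (R_star (s_elem w) l) 1"
      by (simp add: pairing_R_star)
    then show ?thesis using inv[OF False] by (simp add: pairing_s_elem pairing_def)
  qed
qed

lemma coll_degree_pos_iff: "coll_degree w > 0 \<longleftrightarrow> w \<noteq> {#}"
  by (simp add: coll_degree_weight) (metis weight_eq_0_iff neq0_conv)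

section \<open>The logarithm\<close>

lemma ex_log_series:
  obtains g where "g oo gen_series = fps_X" "gen_series oo g = fps_X" "g $ 0 = 0"
    "\<And>h. invariant_series h \<longleftrightarrow> h = g"
proof -
  obtain g where g: "g $ 0 = 0" "g $ 1 = 1" "g oo gen_series = fps_X" "gen_series oo g = fps_X"
    using ex_compositional_inverse[OF gen_series_0 gen_series_1] by blast
  \<comment> \<open>The equation g oo \<sigma> = X is triangular with diagonal 1, so homogeneity
    propagates by strong induction.\<close>
  have hom: "g $ n \<in> dual_component (2 - 2 * int n)" for n
  proof (induction n rule: less_induct)
    case (less n)
    have "fps_X $ n = (\<Sum>i<n. g $ i * (gen_series ^ i) $ n) + g $ n"
      using startsby_zero_power_nth_same[OF gen_series_0, of n] gen_series_1
      unfolding g(3)[symmetric] fps_compose_nth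
      by (simp add: atLeast0AtMost flip: lessThan_Suc_atMost)
    then have "g $ n = fps_X $ n - (\<Sum>i<n. g $ i * (gen_series ^ i) $ n)"
      by (simp add: algebra_simps)
    also have "\<dots> \<in> dual_component (2 - 2 * int n)"
    proof (intro dual_component_diff dual_component_sum series_componentD series_component_X)
      fix i assume "i \<in> {..<n}"
      then have "g $ i \<in> dual_component (2 - 2 * int i)" using less by simp
      from dual_component_mult[OF this series_componentD[OF
            series_component_power[OF series_component_gen_series, of i], of n]]
      show "g $ i * (gen_series ^ i) $ n \<in> dual_component (2 - 2 * int n)"
        by (simp add: algebra_simps)
    qed
    finally show ?case .
  qed
  have "invariant_series g"
    unfolding invariant_series_def series_act_eq coll_degree_pos_iff invariant_series_iff_coeffs
    using g hom
    by (auto simp: series_component_def fps_X_def cartan_one[OF cartan_R_star] cartan_zero[OF cartan_R_star])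
  moreover have "h = g" if "invariant_series h" for h
  proof -
    have h: "h $ 0 = 0" "h $ 1 = 1" "h \<in> series_component 2"
      "R_star (s_elem w) ((h oo gen_series) $ n) = 0" if "w \<noteq> {#}" for n w
      using \<open>invariant_series h\<close> that
      unfolding invariant_series_def series_act_eq coll_degree_pos_iff invariant_series_iff_coeffs
      by blast+
    \<comment> \<open>The facts in \<open>h\<close> were derived for a given nonempty collection; an
      arbitrary singleton serves for the first three.\<close>
    have ne: "{#undefined#} \<noteq> ({#} :: coll)" by simp
    note h = h(1-3)[OF ne] h(4)
    have "(h oo gen_series) $ n = fps_X $ n" for n
    \<comment> \<open>The degree 2 - 2n is zero only for n = 1, and that coefficient is fixed by the
      normalization.\<close>
    proof (cases "n = 1")
      case True
      then show ?thesis using h gen_series_1 by (simp add: fps_compose_nth)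
    next
      case False
      have "(h oo gen_series) $ n = 0"
      proof (rule invariant_dual_element)
        show "(h oo gen_series) $ n \<in> dual_component (2 - 2 * int n)"
          by (intro series_componentD series_component_compose h series_component_gen_series)
      qed (use h False in auto)
      then show ?thesis using False by (simp add: fps_X_def)
    qed
    then have "h oo gen_series = g oo gen_series" using g by (simp add: fps_eq_iff)
    then show "h = g" using compose_right_cancel[OF gen_series_0 gen_series_1] by blast
  qed
  ultimately show ?thesis using that g by blast
qed

section \<open>Values of invariant series\<close>

lemma filtered_milnor_algebraD:
  assumes "filtered_milnor_algebra A \<iota> F"
  shows "cartan_action A" "unital_ring_hom \<iota>" "filtered_ring F"
    "\<And>s l. A s (\<iota> l) = \<iota> (R_star s l)" "\<And>s n u. u \<in> F n \<Longrightarrow> A s u \<in> F n"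
  using assms unfolding filtered_milnor_algebra_def milnor_module_def
  by (auto intro!: unital_ring_hom.intro filtered_ring.intro)

text \<open>The ring need not be commutative: coefficients stay on the left of powers of \<open>x\<close> throughout.\<close>

lemma value_invariant:
  fixes A :: "LN \<Rightarrow> 'm::ring_1 \<Rightarrow> 'm"
  assumes F: "filtered_milnor_algebra A \<iota> F"
    and x: "geometric_operations A x" "x \<in> F 1"
    and y: "is_series_value \<iota> F g x y"
    and g: "\<And>w. w \<noteq> {#} \<Longrightarrow> ext_action R_star (s_elem w) g = 0"
    and w: "w \<noteq> {#}"
  shows "A (s_elem w) y = 0"
proof -
  note F = filtered_milnor_algebraD[OF F]
  note A = F(1)
  interpret \<iota>: unital_ring_hom \<iota> by (rule F(2))
  interpret filtered_ring F by (rule F(3))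
  have "A (s_elem w) y - 0 \<in> F n" for n
  proof -
    let ?t = "\<lambda>i (u, v). \<iota> (R_star (s_elem u) (g $ i) * of_int (power_coeff i v))"
    let ?e = "\<lambda>i (u, v). weight v + i"
    have x_pow: "a * (of_int c * b) = a * of_int c * b" for a b :: 'm and c
      by (simp add: mult.assoc)
    have act: "A (s_elem w) (\<Sum>i<n. \<iota> (g $ i) * x ^ i) =
        (\<Sum>i<n. \<Sum>p\<in>splittings w. ?t i p * x ^ ?e i p)"
      by (simp add: cartan_sum[OF A] cartan_mult[OF A] geometric_power[OF A x(1)] F(4) x_pow case_prod_beta)
    \<comment> \<open>The vanishing of s_w(g) is transported by \<iota>; it cancels all terms with
      exponent below n.\<close>
    have "0 = (\<Sum>m<n. \<iota> (ext_action R_star (s_elem w) g $ m) * x ^ m)"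
      using g[OF w] by simp
    also have "\<dots> = (\<Sum>m<n. \<Sum>i\<le>m. \<Sum>p\<in>splittings w. if m = ?e i p then ?t i p * x ^ m else 0)"
      unfolding ext_action_nth_explicit \<iota>.map_sum sum_distrib_right
      by (intro sum.cong refl) auto
    also have "\<dots> = (\<Sum>m<n. \<Sum>i<n. \<Sum>p\<in>splittings w. if m = ?e i p then ?t i p * x ^ m else 0)"
      by (intro sum.cong[OF refl] sum.mono_neutral_left) (auto intro!: sum.neutral)
    also have "\<dots> = (\<Sum>i<n. \<Sum>p\<in>splittings w. \<Sum>m<n. if m = ?e i p then ?t i p * x ^ m else 0)"
      by (subst sum.swap) (intro sum.cong[OF refl] sum.swap)
    also have "\<dots> = (\<Sum>i<n. \<Sum>p\<in>splittings w. if ?e i p < n then ?t i p * x ^ ?e i p else 0)"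
      by (intro sum.cong[OF refl]) simp
    finally have "A (s_elem w) (\<Sum>i<n. \<iota> (g $ i) * x ^ i) =
        (\<Sum>i<n. \<Sum>p\<in>splittings w. ?t i p * x ^ ?e i p) -
        (\<Sum>i<n. \<Sum>p\<in>splittings w. if ?e i p < n then ?t i p * x ^ ?e i p else 0)"
      using act by simp
    \<comment> \<open>What is left are the terms whose exponent was raised to n or beyond.\<close>
    also have "\<dots> = (\<Sum>i<n. \<Sum>p\<in>splittings w. if ?e i p < n then 0 else ?t i p * x ^ ?e i p)"
      unfolding sum_subtractf[symmetric] by (intro sum.cong[OF refl]) auto
    also have "\<dots> \<in> F n"
    proof (intro J_sum)
      fix i p
      show "(if ?e i p < n then 0 else ?t i p * x ^ ?e i p) \<in> F n"
        using J_mult_left[of "x ^ ?e i p" n "?t i p"] J_power[OF x(2), of "?e i p"] J_mono[of n "?e i p", THEN subsetD] J_zero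
        by auto
    qed
    finally have p: "A (s_elem w) (\<Sum>i<n. \<iota> (g $ i) * x ^ i) \<in> F n" .
    have "A (s_elem w) (y - (\<Sum>i<n. \<iota> (g $ i) * x ^ i)) \<in> F n"
      using y by (intro F(5)) (simp add: is_series_value_def)
    from J_add[OF this p] show ?thesis by (simp add: cartan_diff[OF A])
  qed
  then show ?thesis by (rule J_eqI)
qed

section \<open>The formal group\<close>

definition order2 :: "nat \<Rightarrow> LNdual fps fps set" where
  "order2 n = {F. \<forall>i j. i + j < n \<longrightarrow> F $ j $ i = 0}"

definition const2 :: "LNdual \<Rightarrow> LNdual fps fps" where
  "const2 l = fps_const (fps_const l)"

lemma filtered_algebra_order2: "filtered_algebra const2 order2"
proof
  show "u * v \<in> order2 (m + n)" if "u \<in> order2 m" "v \<in> order2 n" for u v m n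
    unfolding order2_def
  proof (clarify)
    fix i j assume ij: "i + j < m + n"
    have "u $ b $ a * v $ (j - b) $ (i - a) = 0" if "b \<le> j" "a \<le> i" for a b
      using that ij \<open>u \<in> _\<close> \<open>v \<in> _\<close> by (cases "a + b < m") (auto simp: order2_def)
    then show "(u * v) $ j $ i = 0" by (simp add: fps_mult_nth fps_sum_nth)
  qed
  show "(\<Inter>n. order2 n) = {0}"
    by (auto simp: order2_def fps_eq_iff, metis lessI)
qed (auto simp: const2_def order2_def)

interpretation order2: filtered_algebra const2 order2
  by (rule filtered_algebra_order2)

lemma order2_1_iff: "F \<in> order2 1 \<longleftrightarrow> F $ 0 $ 0 = 0"
  by (simp add: order2_def)

lemma value_of_subst2:
  assumes F: "F \<in> order2 1"
  shows "order2.value_of g F (subst2 g F)"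
  unfolding order2.value_of_def
proof
  fix n
  have "subst2 g F $ j $ i = (\<Sum>k<n. const2 (g $ k) * F ^ k) $ j $ i" if "i + j < n" for i j
  proof -
    have "(F ^ k) $ j $ i = 0" if "i + j < k" for k
      using order2.J_power[OF F, of k] that by (simp add: order2_def)
    then have "(\<Sum>k\<le>i + j. g $ k * (F ^ k) $ j $ i) = (\<Sum>k<n. g $ k * (F ^ k) $ j $ i)"
      using that by (intro sum.mono_neutral_left) auto
    then show ?thesis by (simp add: subst2_def fps_sum_nth const2_def)
  qed
  then show "subst2 g F - (\<Sum>k<n. const2 (g $ k) * F ^ k) \<in> order2 n"
    by (simp add: order2_def)
qed

lemma subst2_compose:
  assumes "F \<in> order2 1" "g $ 0 = 0" "subst2 g F \<in> order2 1"
  shows "subst2 h (subst2 g F) = subst2 (h oo g) F"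
  using assms
  by (intro order2.value_of_unique[OF order2.value_of_compose value_of_subst2])
    (auto intro: value_of_subst2)

lemma subst2_X: "F \<in> order2 1 \<Longrightarrow> subst2 fps_X F = F"
  by (rule order2.value_of_unique[OF value_of_subst2 order2.value_of_X])

text \<open>Restriction to x_2 = 0; \<open>subst2_column_0\<close> is the restriction to x_1 = 0.
  They turn conditions on the axes into one-variable composition.\<close>

lemma subst2_nth_0: "subst2 h F $ 0 = h oo F $ 0"
  by (rule fps_ext) (simp add: subst2_def fps_compose_nth fps_power_zeroth atLeast0AtMost)

lemma fps_nth_0_hom: "unital_ring_hom (\<lambda>c :: 'a::ring_1 fps. c $ 0)"
  by standard auto

lemma subst2_column_0: "map_fps (\<lambda>c. c $ 0) (subst2 h F) = h oo map_fps (\<lambda>c. c $ 0) F"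
proof (rule fps_ext)
  interpret unital_ring_hom "map_fps (\<lambda>c :: LNdual fps. c $ 0)"
    by (rule unital_ring_hom.map_fps_hom[OF fps_nth_0_hom])
  show "map_fps (\<lambda>c. c $ 0) (subst2 h F) $ n = (h oo map_fps (\<lambda>c. c $ 0) F) $ n" for n
    by (simp add: subst2_def fps_compose_nth atLeast0AtMost flip: map_power)
qed

text \<open>The coefficient of degree m in s(G) involves only coefficients of G up to degree m; this
  is used in each variable.\<close>

lemma order2_act:
  assumes "F \<in> order2 n"
  shows "series2_act s F \<in> order2 n"
proof -
  have low: "ext_action A s G $ m = 0" if "cartan_action A" "\<And>i. i \<le> m \<Longrightarrow> G $ i = 0"
    for A :: "LN \<Rightarrow> 'b::comm_ring_1 \<Rightarrow> 'b" and s G m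
  proof -
    have "ext_action A (s_elem w) G $ m = 0" for w
      unfolding ext_action_nth_explicit
      by (intro sum.neutral ballI) (auto simp: that cartan_zero)
    moreover have "ext_action A s G $ m = lin_ext (\<lambda>w. ext_action A (s_elem w) G $ m) s"
      by (rule additive_eq_lin_ext) (simp add: cartan_add_left[OF cartan_ext_action[OF that(1)]])
    ultimately show ?thesis by (simp add: lin_ext_def)
  qed
  have "series2_act (s_elem w) F \<in> order2 n" for w
    unfolding order2_def
  proof (clarify)
    fix i j assume ij: "i + j < n"
    have "ext_action R_star (s_elem u) (F $ k) $ i = 0" if "k \<le> j" for u k
      using assms ij that by (intro low cartan_R_star) (auto simp: order2_def)
    then show "series2_act (s_elem w) F $ j $ i = 0"
      unfolding series2_act_eq ext_action_nth_explicit[of "ext_action R_star"] fps_sum_nth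
      by (intro sum.neutral ballI) (auto simp: fps_sum_nth simp flip: fps_of_int intro!: sum.neutral)
  qed
  then show ?thesis
    unfolding series2_act_eq cartan_lin_ext[OF cartan_ext2_R_star, of s] lin_ext_def
    by (intro order2.J_sum order2.J_mult_left)
qed

section \<open>The two-variable ring as a filtered Milnor algebra\<close>

lemma series2_act_const2: "series2_act s (const2 l) = const2 (R_star s l)"
  by (simp add: series2_act_eq const2_def ext_action_const cartan_R_star cartan_ext_R_star)

lemma filtered_milnor_algebra_series2: "filtered_milnor_algebra series2_act const2 order2"
  unfolding filtered_milnor_algebra_def
  using order2.J_0 order2.J_Suc order2.J_Inter order2.J_diff order2.J_mult order2_act
  by (simp add: series2_act_const2)
    (simp add: series2_act_eq milnor_ext_action milnor_module_R_star)

lemma geometric_series2_var: "geometric_operations series2_act var1" "geometric_operations series2_act var2"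
  by (simp_all add: series2_act_eq var1_def var2_def geometric_ext_action_X geometric_ext_action_const
      cartan_R_star cartan_ext_R_star)

lemma subst2_invariant:
  assumes "F \<in> order2 1" "geometric_operations series2_act F"
    and "\<And>w. w \<noteq> {#} \<Longrightarrow> ext_action R_star (s_elem w) g = 0" "w \<noteq> {#}"
  shows "series2_act (s_elem w) (subst2 g F) = 0"
  using value_invariant[OF filtered_milnor_algebra_series2 assms(2,1) _ assms(3,4)]
    value_of_subst2[OF assms(1)]
  by (simp add: is_series_value_def order2.value_of_def)

text \<open>Powers of an invariant y are invariant since the total operation is multiplicative. In
  the Cartan formula only the splitting with v empty survives, so y behaves like a constant.\<close>

lemma act_subst2_of_invariant:
  assumes y: "y \<in> order2 1" and inv: "\<And>w. w \<noteq> {#} \<Longrightarrow> series2_act (s_elem w) y = 0"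
  shows "series2_act (s_elem w) (subst2 h y) = subst2 (map_fps (R_star (s_elem w)) h) y"
proof (rule order2.value_of_unique[OF _ value_of_subst2[OF y]])
  note E = cartan_ext2_R_star[folded series2_act_eq]
  interpret T: unital_ring_hom "total_op series2_act" by (rule total_hom[OF E])
  interpret K: unital_ring_hom "const_op :: LNdual fps fps \<Rightarrow> _" by (rule const_op_hom)
  have "total_op series2_act (y ^ i) = const_op (y ^ i)" for i
    using total_eq_const_op_iff[OF E, of y] inv by simp
  then have pow: "series2_act (s_elem v) (y ^ i) = (if v = {#} then y ^ i else 0)" for v i
    by (metis op_coeff_total_op op_coeff_const_op)
  have act: "series2_act (s_elem w) (const2 l * y ^ i) = const2 (R_star (s_elem w) l) * y ^ i" for l i
  proof -
    have "series2_act (s_elem w) (const2 l * y ^ i) =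
        (\<Sum>(u, v)\<in>splittings w. if v = {#} then const2 (R_star (s_elem u) l) * y ^ i else 0)"
      unfolding cartan_mult[OF E] by (rule sum.cong) (auto simp: pow series2_act_const2)
    then show ?thesis by (simp add: sum_splittings_delta)
  qed
  show "order2.value_of (map_fps (R_star (s_elem w)) h) y (series2_act (s_elem w) (subst2 h y))"
    unfolding order2.value_of_def
  proof
    fix n
    have "series2_act (s_elem w) (subst2 h y - (\<Sum>i<n. const2 (h $ i) * y ^ i)) \<in> order2 n"
      using value_of_subst2[OF y] by (intro order2_act) (simp add: order2.value_of_def)
    then show "series2_act (s_elem w) (subst2 h y) -
        (\<Sum>i<n. const2 (map_fps (R_star (s_elem w)) h $ i) * y ^ i) \<in> order2 n"
      by (simp add: cartan_diff[OF E] cartan_sum[OF E] act)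
  qed
qed

lemma invariant_series2_eq_0:
  assumes d: "d \<in> series2_component 2" and inv: "\<And>w. w \<noteq> {#} \<Longrightarrow> series2_act (s_elem w) d = 0"
    and rows: "d $ 0 = 0" "d $ 1 $ 0 = 0"
  shows "d = 0"
proof -
  let ?\<sigma> = "map_fps fps_const gen_series"
  interpret C: unital_ring_hom "map_fps (fps_const :: LNdual \<Rightarrow> _)"
    by (rule unital_ring_hom.map_fps_hom[OF fps_const_hom])
  have \<sigma>: "?\<sigma> $ 0 = 0" "?\<sigma> $ 1 = 1" using gen_series_0 gen_series_1 by simp_all
  let ?h = "\<lambda>n. (d oo ?\<sigma>) $ n"
  have h: "?h n \<in> series_component (2 - 2 * int n)" for n
  proof -
    have "d $ i * fps_const (gen_series ^ i $ n) \<in> series_component (2 - 2 * int n)" for i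
    proof -
      have "d $ i $ m * (gen_series ^ i $ n) \<in> dual_component (2 - 2 * int n - 2 * int m)" for m
      proof -
        have "d $ i $ m \<in> dual_component (2 - 2 * int m - 2 * int i)"
          using d by (simp add: series2_component_def)
        from dual_component_mult[OF this series_componentD[OF
              series_component_power[OF series_component_gen_series, of i], of n]]
        show ?thesis by (simp add: algebra_simps)
      qed
      then show ?thesis by (simp add: series_component_def)
    qed
    then show ?thesis
      by (auto simp: fps_compose_nth simp flip: C.map_power intro!: series_component_sum)
  qed
  have "\<forall>n w. w \<noteq> {#} \<longrightarrow> ext_action R_star (s_elem w) (?h n) = 0"
    using inv by (simp add: series2_act_eq flip: invariant_series2_iff_coeffs)
  then have k: "w \<noteq> {#} \<Longrightarrow> R_star (s_elem w) ((?h n oo gen_series) $ m) = 0" for n m w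
    using invariant_series_iff_coeffs[of "?h n"] by blast
  have "(?h n oo gen_series) $ m = 0" for n m
  \<comment> \<open>The degree 2 - 2n - 2m is zero exactly here, where the linear coefficients
    vanish by \<open>rows\<close>.\<close>
  proof (cases "n + m = 1")
    case True
    have "?h 0 = 0" using rows by simp
    moreover have "?h 1 $ 0 = 0" using rows \<sigma> by (simp add: fps_compose_nth)
    ultimately show ?thesis using True by (cases n) auto
  next
    case False
    show ?thesis
    proof (rule invariant_dual_element[OF k])
      show "(?h n oo gen_series) $ m \<in> dual_component (2 - 2 * int n - 2 * int m)"
        by (intro series_componentD series_component_compose h series_component_gen_series)
    qed (use False in auto)
  qed
  then have "?h n oo gen_series = 0 oo gen_series" for n by (simp add: fps_eq_iff)
  then have "?h n = 0" for n using compose_right_cancel[OF gen_series_0 gen_series_1] by blast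
  then have "d oo ?\<sigma> = 0 oo ?\<sigma>" by (simp add: fps_eq_iff)
  then show "d = 0" using compose_right_cancel[OF \<sigma>] by blast
qed

text \<open>For another candidate f, the difference g(f) - y is invariant of degree 2 and vanishes
  on both axes, hence is 0; applying \<sigma> recovers f.\<close>

lemma formal_group_eq:
  assumes g: "gen_series oo g = fps_X" "g $ 0 = 0" "invariant_series g"
  shows "formal_group = subst2 gen_series (subst2 g var1 + subst2 g var2)" (is "_ = ?f")
  unfolding formal_group_def
proof (rule the_equality)
  note E = cartan_ext2_R_star[folded series2_act_eq]
  have inv: "w \<noteq> {#} \<Longrightarrow> ext_action R_star (s_elem w) g = 0" for w
    using g(3) by (simp add: invariant_series_def series_act_eq coll_degree_pos_iff)
  have g2: "g \<in> series_component 2" using g(3) by (simp add: invariant_series_def)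
  let ?c = "map_fps (\<lambda>c :: LNdual fps. c $ 0)"
  interpret c: unital_ring_hom ?c
    by (rule unital_ring_hom.map_fps_hom[OF fps_nth_0_hom])
  let ?y = "subst2 g var1 + subst2 g var2"
  have var: "var1 \<in> order2 1" "var2 \<in> order2 1" unfolding order2_1_iff by (simp_all add: var1_def var2_def)
  have col: "?c var1 = 0" "?c var2 = fps_X"
    by (auto simp: fps_eq_iff var1_def var2_def fps_X_def)
  have row: "var1 $ 0 = fps_X" "var2 $ 0 = 0" by (simp_all add: var1_def var2_def)
  have y_row: "?y $ 0 = g" by (simp add: subst2_nth_0 row g(2))
  have y_col: "?c ?y = g"
    by (simp only: c.map_add subst2_column_0 col) (simp add: g(2))
  have y: "?y \<in> order2 1" using y_row g(2) unfolding order2_1_iff by simp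
  have y_inv: "w \<noteq> {#} \<Longrightarrow> series2_act (s_elem w) ?y = 0" for w
    using subst2_invariant[OF var(1) geometric_series2_var(1) inv]
      subst2_invariant[OF var(2) geometric_series2_var(2) inv] by (simp add: cartan_add[OF E])
  have y_hom: "?y \<in> series2_component 2"
    by (intro series2_component_add series2_component_subst2 series2_component_var g2)
  have "geometric_operations series2_act ?f"
    unfolding geometric_operations_weight[OF E]
  proof
    fix w
    have "map_fps (R_star (s_elem w)) gen_series = (if size w \<le> 1 then gen_series ^ (weight w + 1) else 0)"
      by (simp add: fps_eq_iff R_star_gen_series del: power_Suc)
    then have "series2_act (s_elem w) ?f =
        subst2 (if size w \<le> 1 then gen_series ^ (weight w + 1) else 0) ?y"
      using act_subst2_of_invariant[OF y y_inv, of w gen_series] by simp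
    also have "\<dots> = (if size w \<le> 1 then ?f ^ (weight w + 1) else 0)"
    proof -
      have "subst2 (gen_series ^ k) ?y = ?f ^ k" for k
        by (rule order2.value_of_unique[OF value_of_subst2[OF y] order2.value_of_power[OF y value_of_subst2[OF y]]])
      moreover have "subst2 0 ?y = 0" by (simp add: subst2_def fps_eq_iff)
      ultimately show ?thesis by (simp del: power_Suc)
    qed
    finally show "series2_act (s_elem w) ?f = (if size w \<le> 1 then ?f ^ (weight w + 1) else 0)" .
  qed
  moreover have "?f $ j $ i = (if i + j = 1 then 1 else 0)" if "i = 0 \<or> j = 0" for i j
  proof -
    \<comment> \<open>On each axis y restricts to g, so \<sigma>(y) restricts to \<sigma>(g(x)) =
      x.\<close>
    have "?f $ 0 = fps_X" by (simp only: subst2_nth_0 y_row g)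
    moreover have "?f $ j $ 0 = fps_X $ j"
      using arg_cong[OF y_col, of "\<lambda>c. (gen_series oo c) $ j"]
      by (simp only: subst2_column_0[symmetric] map_fps_nth g)
    ultimately show ?thesis using that by (auto simp: fps_X_def)
  qed
  moreover have "?f \<in> series2_component 2"
    by (intro series2_component_subst2 series_component_gen_series y_hom)
  ultimately show "(\<forall>i j. i = 0 \<or> j = 0 \<longrightarrow> ?f $ j $ i = (if i + j = 1 then 1 else 0)) \<and>
      geometric_cobordism series2_act series2_component ?f"
    by (simp add: geometric_cobordism_def)

  fix f
  assume f: "(\<forall>i j. i = 0 \<or> j = 0 \<longrightarrow> f $ j $ i = (if i + j = 1 then 1 else 0)) \<and>
      geometric_cobordism series2_act series2_component f"
  have f1: "f \<in> order2 1" using f unfolding order2_1_iff by simp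
  have f_row: "f $ 0 = fps_X" and f_col: "?c f = fps_X"
    using f by (auto simp: fps_eq_iff fps_X_def)
  have row0: "subst2 g f $ 0 = g" by (simp add: subst2_nth_0 f_row)
  have col0: "?c (subst2 g f) = g" by (simp add: subst2_column_0 f_col)
  have "subst2 g f - ?y = 0"
  proof (rule invariant_series2_eq_0)
    show "subst2 g f - ?y \<in> series2_component 2"
      using f by (intro series2_component_diff series2_component_subst2 g2 y_hom)
        (simp add: geometric_cobordism_def)
    show "series2_act (s_elem w) (subst2 g f - ?y) = 0" if "w \<noteq> {#}" for w
      using f that subst2_invariant[OF f1 _ inv] y_inv
      by (simp add: cartan_diff[OF E] geometric_cobordism_def)
    show "(subst2 g f - ?y) $ 0 = 0" using row0 y_row by simp
    have "?c (subst2 g f - ?y) = 0" using col0 y_col by simp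
    then show "(subst2 g f - ?y) $ 1 $ 0 = 0" by (metis map_fps_nth fps_zero_nth)
  qed
  then have "?f = subst2 gen_series (subst2 g f)" by simp
  moreover have "subst2 g f \<in> order2 1" unfolding order2_1_iff using row0 g(2) by simp
  ultimately show "f = ?f" using subst2_compose[OF f1 g(2)] by (simp add: g subst2_X[OF f1])
qed

theorem lemma3:
  "(\<exists>!g. invariant_series g) \<and>
   (\<forall>g. invariant_series g \<longrightarrow>
      (\<forall>(A :: LN \<Rightarrow> 'm::ring_1 \<Rightarrow> 'm) \<iota> F gr x y w.
         filtered_milnor_algebra A \<iota> F \<and> geometric_cobordism A gr x \<and> x \<in> F 1 \<and>
         is_series_value \<iota> F g x y \<and> coll_degree w > 0 \<longrightarrow> A (s_elem w) y = 0) \<and>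
      formal_group = subst2 (comp_inverse g) (subst2 g var1 + subst2 g var2) \<and>
      fps_X = g + (dual_series oo g) \<and>
      comp_inverse g = fps_X + dual_series)"
proof -
  obtain g where g: "g oo gen_series = fps_X" "gen_series oo g = fps_X" "g $ 0 = 0"
    and unique: "\<And>h. invariant_series h \<longleftrightarrow> h = g"
    using ex_log_series by blast
  have comp: "comp_inverse g = gen_series"
    by (rule comp_inverse_eq) (use g gen_series_0 in auto)
  have inv: "w \<noteq> {#} \<Longrightarrow> ext_action R_star (s_elem w) g = 0" for w
    using unique[of g] by (simp add: invariant_series_def series_act_eq coll_degree_pos_iff)
  have "A (s_elem w) y = 0"
    if "filtered_milnor_algebra A \<iota> F" "geometric_cobordism A gr x" "x \<in> F 1"
      "is_series_value \<iota> F g x y" "coll_degree w > 0"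
    for A :: "LN \<Rightarrow> 'm \<Rightarrow> 'm" and \<iota> F gr x y w
    using that value_invariant[OF that(1) _ that(3,4) inv]
    by (simp add: geometric_cobordism_def coll_degree_pos_iff)
  then have "\<forall>(A :: LN \<Rightarrow> 'm \<Rightarrow> 'm) \<iota> F gr x y w.
      filtered_milnor_algebra A \<iota> F \<and> geometric_cobordism A gr x \<and> x \<in> F 1 \<and>
      is_series_value \<iota> F g x y \<and> coll_degree w > 0 \<longrightarrow> A (s_elem w) y = 0"
    by blast
  moreover have "formal_group = subst2 (comp_inverse g) (subst2 g var1 + subst2 g var2)"
    unfolding comp using g unique by (intro formal_group_eq) auto
  \<comment> \<open>This is \<sigma> oo g = X with the linear term of \<sigma> split off.\<close>
  moreover have "fps_X = g + (dual_series oo g)"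
    using g by (simp add: gen_series_def fps_compose_add_distrib)
  moreover have "comp_inverse g = fps_X + dual_series"
    by (simp add: comp gen_series_def)
  ultimately show ?thesis using unique by simp
qed

end
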